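(* Let $(V,\varphi)$ be an $SL(2,\mathbb{C})$-Higgs bundle on $\Sigma$ with symplectic form $\omega$ on $V$, and consider the $SL(2,\mathbb{C})\times SL(2,\mathbb{C})$-Higgs bundle $((V,\varphi),(V,-\varphi))$, also written $\left(V\oplus V,\begin{pmatrix}\varphi&0\\0&-\varphi\end{pmatrix}\right)$. Then the map $\mathcal{I}_2$ on Higgs bundles satisfies $$\mathcal{I}_2\left(V\oplus V,\begin{pmatrix}\varphi&0\\0&-\varphi\end{pmatrix}\right)=\left(\mathcal{O}\oplus \mathrm{Sym}^2V,\begin{pmatrix}0&\beta\\-\beta^T&0\end{pmatrix}\right),$$ where, locally, $\beta=\begin{bmatrix}-c&2a&b\end{bmatrix}$ when $\varphi=\begin{bmatrix}a&b\\c&-a\end{bmatrix}$ (with respect to the frames described in the context), and the orthogonal structure on $\mathrm{Sym}^2V$ is the one induced by the symplectic structure $\omega$ on $V$. Moreover, if $\left(\mathcal{O}\oplus W,\Phi\right)$ with $\Phi=\begin{pmatrix}0&\beta\\-\beta^T&0\end{pmatrix}$ represents a point in the component $\mathcal{M}^+(SO_0(1,3))\subset \mathcal{M}^+(SO(4,\mathbb{C}))$, then $W=\mathrm{Sym}^2V$ for a rank two bundle $V$ with trivial determinant, with the orthogonal structure on $W$ being the one induced on $\mathrm{Sym}^2V$ by the symplectic structure of $V$.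
   Context: $\Sigma$ is a fixed compact Riemann surface of genus $g\ge 2$ with canonical bundle $K$. An $SL(2,\mathbb{C})$-Higgs bundle is a pair $(V,\varphi)$ with $V$ a rank 2 holomorphic vector bundle with trivialized determinant (equivalently with a symplectic form $\omega$) and $\varphi:V\to V\otimes K$ holomorphic with $\mathrm{Tr}(\varphi)=0$. An $SO(4,\mathbb{C})$-Higgs bundle is $(E,Q,\Phi)$ with $E$ a rank 4 holomorphic bundle, $Q$ a nondegenerate symmetric bilinear form, a compatible trivialization of $\Lambda^4E$, and $\Phi\in H^0(\Sigma,\mathrm{End}(E)\otimes K)$ skew-symmetric with respect to $Q$. The isogeny $SL(2,\mathbb{C})\times SL(2,\mathbb{C})\to SO(4,\mathbb{C})=SO(\mathbb{C}^2\otimes\mathbb{C}^2,\omega\otimes\omega)$, $(g_1,g_2)\mapsto g_1\otimes g_2$, induces the map on Higgs bundles $$\mathcal{I}_2((V_1,\varphi_1),(V_2,\varphi_2))=(V_1\otimes V_2,\ \omega_1\otimes\omega_2,\ \varphi_1\otimes \mathrm{Id}+\mathrm{Id}\otimes\varphi_2),$$ where $\omega_i$ is the symplectic form on $V_i$. $V\otimes V\simeq\Lambda^2V\oplus \mathrm{Sym}^2V=\mathcal{O}\oplus \mathrm{Sym}^2V$, with orthogonal structures on $\mathcal{O}$ and $\mathrm{Sym}^2V$ the restrictions of $\omega\otimes\omega$. Frames: choose a local frame $\{e,f\}$ of $V$ in which $\omega=\begin{bmatrix}0&1\\-1&0\end{bmatrix}$; use the frame $e\otimes f-f\otimes e$ for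 $\mathcal{O}=\Lambda^2V$ and $\{e\otimes e,\ e\otimes f+f\otimes e,\ f\otimes f\}$ for $\mathrm{Sym}^2V$. The transpose $\beta^T$ is taken with respect to the orthogonal structures: $\beta^T=q_3^{-1}\beta^tq_1$, where $q_1$, $q_3$ are the matrices of the quadratic forms on $\mathcal{O}$ and $\mathrm{Sym}^2V$ (or $W$). An $SO_0(1,3)$-Higgs bundle is a triple $(\mathcal{O},W,\beta)$ with $W$ a rank 3 orthogonal bundle with trivial determinant and $\beta:W\to K$ holomorphic; viewed as an $SO(4,\mathbb{C})$-Higgs bundle it is $\left(\mathcal{O}\oplus W,\begin{pmatrix}0&\beta\\-\beta^T&0\end{pmatrix}\right)$ with the direct sum orthogonal structure. $\mathcal{M}(SO_0(1,3))$ and $\mathcal{M}(SO(4,\mathbb{C}))$ are the moduli spaces of (polystable) Higgs bundles, and $\mathcal{M}^+$ denotes the component where the second Stiefel–Whitney class ($w_2(W)$, respectively $w_2(E)$) vanishes. *)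

theory Defs
  imports
    "HOL-Complex_Analysis.Complex_Analysis"
    "HOL-Homology.Homology"
    "HOL-Algebra.Free_Abelian_Groups"
    "HOL-Library.Z2"
begin

section \<open>Compact Riemann surfaces\<close>

text \<open>A local coordinate is a pair (U, z) of an open set and a coordinate function on it; the
  complex structure of the surface, whose points are the elements of the type \<open>'a\<close>, is an
  atlas of local coordinates.\<close>

type_synonym 'a chart = "'a set \<times> ('a \<Rightarrow> complex)"

definition chart_inv :: "'a chart \<Rightarrow> complex \<Rightarrow> 'a" where
  "chart_inv c = inv_into (fst c) (snd c)"

definition riemann_surface :: "'a::t2_space chart set \<Rightarrow> bool" where
  "riemann_surface X \<longleftrightarrow>
     (\<Union>c\<in>X. fst c) = UNIV \<and>
     (\<forall>c\<in>X. open (fst c) \<and> open (snd c ` fst c) \<and>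
        homeomorphism (fst c) (snd c ` fst c) (snd c) (chart_inv c)) \<and>
     (\<forall>c\<in>X. \<forall>c'\<in>X. (snd c' \<circ> chart_inv c) holomorphic_on snd c ` (fst c \<inter> fst c'))"

text \<open>The genus is half the rank of the first integral homology group.\<close>

definition compact_riemann_surface :: "'a::t2_space chart set \<Rightarrow> nat \<Rightarrow> bool" where
  "compact_riemann_surface X g \<longleftrightarrow>
     riemann_surface X \<and> compact (UNIV :: 'a set) \<and> connected (UNIV :: 'a set) \<and>
     homology_group 1 (euclidean :: 'a topology) \<cong> free_Abelian_group {..<2 * g}"

definition holo_on :: "'a chart set \<Rightarrow> 'a set \<Rightarrow> ('a \<Rightarrow> complex) \<Rightarrow> bool" where
  "holo_on X S f \<longleftrightarrow> (\<forall>c\<in>X. (f \<circ> chart_inv c) holomorphic_on snd c ` (fst c \<inter> S))"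

definition mero_on :: "'a chart set \<Rightarrow> 'a set \<Rightarrow> ('a \<Rightarrow> complex) \<Rightarrow> bool" where
  "mero_on X S f \<longleftrightarrow> (\<forall>c\<in>X. (f \<circ> chart_inv c) meromorphic_on snd c ` (fst c \<inter> S))"

definition matrix_holo_on :: "'a chart set \<Rightarrow> 'a set \<Rightarrow> ('a \<Rightarrow> complex^'n^'m) \<Rightarrow> bool" where
  "matrix_holo_on X S A \<longleftrightarrow> (\<forall>i j. holo_on X S (\<lambda>x. A x $ i $ j))"

text \<open>A matrix of sections of the canonical bundle K is given by its coefficient in each local
  coordinate: \<open>A c x\<close> is the matrix for which the section at x is \<open>A c x\<close> times dz, where z is
  the coordinate function of the chart c. Coefficients are constrained only for charts of the
  atlas and at points of their domain.\<close>

definition canonical_valued :: "'a chart set \<Rightarrow> ('a chart \<Rightarrow> 'a \<Rightarrow> complex^'n^'m) \<Rightarrow> bool" where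
  "canonical_valued X A \<longleftrightarrow>
     (\<forall>c\<in>X. \<forall>c'\<in>X. \<forall>x\<in>fst c \<inter> fst c'. \<forall>i j.
        A c x $ i $ j = deriv (snd c' \<circ> chart_inv c) (snd c x) * A c' x $ i $ j)"


section \<open>Holomorphic vector bundles\<close>

text \<open>The fibre over every point is identified, as a mere vector space and with no continuity in
  the point, with the space of column vectors indexed by \<open>'n\<close>. The holomorphic structure is a
  set of local frames (S, F): the columns of \<open>F x\<close> are the values at x of the frame, and any two
  frames differ by a holomorphic transition matrix. Every holomorphic vector bundle arises in
  this way (choose a basis of each fibre), and its transition functions are the matrices
  \<open>matrix_inv (F x) ** F' x\<close>.\<close>

type_synonym ('a, 'n) frame = "'a set \<times> ('a \<Rightarrow> complex^'n^'n)"
type_synonym ('a, 'n) vbundle = "('a, 'n) frame set"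

definition holomorphic_bundle :: "'a::t2_space chart set \<Rightarrow> ('a, 'n::finite) vbundle \<Rightarrow> bool" where
  "holomorphic_bundle X E \<longleftrightarrow>
     (\<Union>(S, F)\<in>E. S) = UNIV \<and>
     (\<forall>(S, F)\<in>E. open S \<and> (\<forall>x\<in>S. invertible (F x))) \<and>
     (\<forall>(S, F)\<in>E. \<forall>(S', F')\<in>E. matrix_holo_on X (S \<inter> S') (\<lambda>x. matrix_inv (F x) ** F' x))"

definition local_frame ::
  "'a::t2_space chart set \<Rightarrow> ('a, 'n::finite) vbundle \<Rightarrow> 'a set \<Rightarrow> ('a \<Rightarrow> complex^'n^'n) \<Rightarrow> bool" where
  "local_frame X E S F \<longleftrightarrow> open S \<and> (\<forall>x\<in>S. invertible (F x)) \<and>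
     (\<forall>(S', F')\<in>E. matrix_holo_on X (S \<inter> S') (\<lambda>x. matrix_inv (F' x) ** F x))"

text \<open>Bilinear forms are given by their Gram matrices on the fibres.\<close>

definition holomorphic_form ::
  "'a chart set \<Rightarrow> ('a, 'n::finite) vbundle \<Rightarrow> ('a \<Rightarrow> complex^'n^'n) \<Rightarrow> bool" where
  "holomorphic_form X E Q \<longleftrightarrow>
     (\<forall>(S, F)\<in>E. matrix_holo_on X S (\<lambda>x. transpose (F x) ** Q x ** F x))"

definition holomorphic_endo_K ::
  "'a chart set \<Rightarrow> ('a, 'n::finite) vbundle \<Rightarrow> ('a chart \<Rightarrow> 'a \<Rightarrow> complex^'n^'n) \<Rightarrow> bool" where
  "holomorphic_endo_K X E A \<longleftrightarrow> canonical_valued X A \<and>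
     (\<forall>(S, F)\<in>E. \<forall>c\<in>X. matrix_holo_on X (S \<inter> fst c) (\<lambda>x. matrix_inv (F x) ** A c x ** F x))"

definition bundle_iso :: "'a chart set \<Rightarrow> ('a \<Rightarrow> complex^'n^'m) \<Rightarrow>
    ('a, 'n::finite) vbundle \<Rightarrow> ('a, 'm::finite) vbundle \<Rightarrow> bool" where
  "bundle_iso X T E E' \<longleftrightarrow> (\<forall>x. invertible (T x)) \<and>
     (\<forall>(S, F)\<in>E. \<forall>(S', F')\<in>E'.
        matrix_holo_on X (S \<inter> S') (\<lambda>x. matrix_inv (F' x) ** T x ** F x))"

definition trivial_line :: "('a, 1) vbundle" where
  "trivial_line = {(UNIV, \<lambda>x. mat 1)}"

definition kron :: "complex^'n^'n \<Rightarrow> complex^'m^'m \<Rightarrow> complex^('n \<times> 'm)^('n \<times> 'm)" where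
  "kron A B = (\<chi> p q. A $ fst p $ fst q * B $ snd p $ snd q)"

definition block :: "complex^'n^'n \<Rightarrow> complex^'m^'n \<Rightarrow> complex^'n^'m \<Rightarrow> complex^'m^'m
    \<Rightarrow> complex^('n + 'm)^('n + 'm)" where
  "block A B C D = (\<chi> p q. case p of
       Inl i \<Rightarrow> (case q of Inl j \<Rightarrow> A $ i $ j | Inr j \<Rightarrow> B $ i $ j)
     | Inr i \<Rightarrow> (case q of Inl j \<Rightarrow> C $ i $ j | Inr j \<Rightarrow> D $ i $ j))"

definition tensor_bundle ::
  "('a, 'n::finite) vbundle \<Rightarrow> ('a, 'm::finite) vbundle \<Rightarrow> ('a, 'n \<times> 'm) vbundle" where
  "tensor_bundle E E' =
     {(S \<inter> S', \<lambda>x. kron (F x) (F' x)) | S F S' F'. (S, F) \<in> E \<and> (S', F') \<in> E'}"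

definition sum_bundle ::
  "('a, 'n::finite) vbundle \<Rightarrow> ('a, 'm::finite) vbundle \<Rightarrow> ('a, 'n + 'm) vbundle" where
  "sum_bundle E E' =
     {(S \<inter> S', \<lambda>x. block (F x) 0 0 (F' x)) | S F S' F'. (S, F) \<in> E \<and> (S', F') \<in> E'}"


section \<open>Holomorphic subbundles and degree\<close>

text \<open>A subbundle is a family L of subspaces of the fibres which is locally spanned by part of a
  holomorphic frame; J is the set of positions of the spanning columns, so the rank is
  \<open>card J\<close>.\<close>

definition adapted_frame :: "'a::t2_space chart set \<Rightarrow> ('a, 'n::finite) vbundle \<Rightarrow> 'n set \<Rightarrow>
    ('a \<Rightarrow> (complex^'n) set) \<Rightarrow> ('a, 'n) frame \<Rightarrow> bool" where
  "adapted_frame X E J L SF \<longleftrightarrow> local_frame X E (fst SF) (snd SF) \<and>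
     (\<forall>x\<in>fst SF. L x = vec.span ((\<lambda>j. column j (snd SF x)) ` J))"

definition subbundle :: "'a::t2_space chart set \<Rightarrow> ('a, 'n::finite) vbundle \<Rightarrow> 'n set \<Rightarrow>
    ('a \<Rightarrow> (complex^'n) set) \<Rightarrow> bool" where
  "subbundle X E J L \<longleftrightarrow> (\<forall>x. \<exists>SF. x \<in> fst SF \<and> adapted_frame X E J L SF)"

definition minor_det :: "'n set \<Rightarrow> complex^'n^'n \<Rightarrow> complex" where
  "minor_det J M = det (\<chi> i j. if i \<in> J \<and> j \<in> J then M $ i $ j else if i = j then 1 else 0)"

text \<open>The degree of L is the degree of its determinant line bundle, whose transition functions
  are the J-minors of the transition matrices between adapted frames. It is computed as the
  number of zeros minus poles of a nonzero meromorphic section s, given by its coefficient in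
  every adapted frame.\<close>

definition has_degree :: "'a::t2_space chart set \<Rightarrow> ('a, 'n::finite) vbundle \<Rightarrow> 'n set \<Rightarrow>
    ('a \<Rightarrow> (complex^'n) set) \<Rightarrow> int \<Rightarrow> bool" where
  "has_degree X E J L d \<longleftrightarrow>
     (\<exists>(s :: ('a, 'n) frame \<Rightarrow> 'a \<Rightarrow> complex) ord :: 'a \<Rightarrow> int.
        (\<forall>SF. adapted_frame X E J L SF \<longrightarrow>
           mero_on X (fst SF) (s SF) \<and>
           (\<forall>x\<in>fst SF. \<forall>\<^sub>F y in at x. s SF y \<noteq> 0) \<and>
           (\<forall>SF'. adapted_frame X E J L SF' \<longrightarrow> (\<forall>x\<in>fst SF \<inter> fst SF'.
              s SF x = minor_det J (matrix_inv (snd SF x) ** snd SF' x) * s SF' x)) \<and>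
           (\<forall>c\<in>X. \<forall>x\<in>fst SF \<inter> fst c. ord x = zorder (s SF \<circ> chart_inv c) (snd c x))) \<and>
        finite {x. ord x \<noteq> 0} \<and> d = sum ord {x. ord x \<noteq> 0})"


section \<open>Orthogonal bundles and Higgs bundles for SO(n,C)\<close>

text \<open>An SO(n,C)-bundle, n being the cardinality of \<open>'n\<close>, has a quadratic form (Gram matrix
  \<open>form x\<close>) and a trivialization of its determinant: \<open>vol x\<close> is the value of the volume form
  on the standard basis of the fibre. Compatibility means that orthonormal frames have volume
  1 or -1.\<close>

record ('a, 'n) orth_bundle =
  frames :: "('a, 'n::finite) vbundle"
  form :: "'a \<Rightarrow> complex^'n^'n"
  vol :: "'a \<Rightarrow> complex"

record ('a, 'n) so_higgs = "('a, 'n::finite) orth_bundle" +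
  higgs :: "'a chart \<Rightarrow> 'a \<Rightarrow> complex^'n^'n"

definition orth_bundle :: "'a::t2_space chart set \<Rightarrow> ('a, 'n::finite, 'z) orth_bundle_scheme \<Rightarrow> bool"
  where
  "orth_bundle X E \<longleftrightarrow>
     holomorphic_bundle X (frames E) \<and> holomorphic_form X (frames E) (form E) \<and>
     (\<forall>x. transpose (form E x) = form E x \<and> invertible (form E x)) \<and>
     (\<forall>(S, F)\<in>frames E. holo_on X S (\<lambda>x. vol E x * det (F x))) \<and>
     (\<forall>x. (vol E x)\<^sup>2 = det (form E x))"

definition so_higgs :: "'a::t2_space chart set \<Rightarrow> ('a, 'n::finite) so_higgs \<Rightarrow> bool" where
  "so_higgs X E \<longleftrightarrow> orth_bundle X E \<and> holomorphic_endo_K X (frames E) (higgs E) \<and>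
     (\<forall>c\<in>X. \<forall>x\<in>fst c. transpose (higgs E c x) ** form E x + form E x ** higgs E c x = 0)"

definition orth_iso :: "'a chart set \<Rightarrow> ('a \<Rightarrow> complex^'n^'m) \<Rightarrow>
    ('a, 'n::finite, 'y) orth_bundle_scheme \<Rightarrow> ('a, 'm::finite, 'z) orth_bundle_scheme \<Rightarrow> bool" where
  "orth_iso X T E E' \<longleftrightarrow> bundle_iso X T (frames E) (frames E') \<and>
     (\<forall>x. transpose (T x) ** form E' x ** T x = form E x)"

text \<open>Isomorphism of SO(n,C)-Higgs bundles. When the fibres have different index types, the
  bijection \<open>\<sigma>\<close> between the index types fixes the sign in the comparison of volume forms.\<close>

definition so_higgs_iso :: "'a chart set \<Rightarrow> ('n \<Rightarrow> 'm) \<Rightarrow> ('a \<Rightarrow> complex^'n^'m) \<Rightarrow>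
    ('a, 'n::finite) so_higgs \<Rightarrow> ('a, 'm::finite) so_higgs \<Rightarrow> bool" where
  "so_higgs_iso X \<sigma> T E E' \<longleftrightarrow> orth_iso X T E E' \<and> bij \<sigma> \<and>
     (\<forall>x. vol E x = vol E' x * det (\<chi> i j. T x $ \<sigma> i $ j)) \<and>
     (\<forall>c\<in>X. \<forall>x\<in>fst c. T x ** higgs E c x = higgs E' c x ** T x)"


subsection \<open>Polystability\<close>

definition form_eval :: "complex^'n^'n \<Rightarrow> complex^'n \<Rightarrow> complex^'n \<Rightarrow> complex" where
  "form_eval Q u v = (\<Sum>i\<in>UNIV. \<Sum>j\<in>UNIV. u $ i * Q $ i $ j * v $ j)"

definition isotropic :: "('a, 'n::finite) so_higgs \<Rightarrow> ('a \<Rightarrow> (complex^'n) set) \<Rightarrow> bool" where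
  "isotropic E L \<longleftrightarrow> (\<forall>x. \<forall>u\<in>L x. \<forall>v\<in>L x. form_eval (form E x) u v = 0)"

definition coisotropic :: "('a, 'n::finite) so_higgs \<Rightarrow> ('a \<Rightarrow> (complex^'n) set) \<Rightarrow> bool" where
  "coisotropic E L \<longleftrightarrow> (\<forall>x u. (\<forall>v\<in>L x. form_eval (form E x) u v = 0) \<longrightarrow> u \<in> L x)"

definition higgs_invariant ::
  "'a chart set \<Rightarrow> ('a, 'n::finite) so_higgs \<Rightarrow> ('a \<Rightarrow> (complex^'n) set) \<Rightarrow> bool" where
  "higgs_invariant X E L \<longleftrightarrow> (\<forall>c\<in>X. \<forall>x\<in>fst c. \<forall>u\<in>L x. higgs E c x *v u \<in> L x)"

definition semistable :: "'a::t2_space chart set \<Rightarrow> ('a, 'n::finite) so_higgs \<Rightarrow> bool" where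
  "semistable X E \<longleftrightarrow>
     (\<forall>J L d. subbundle X (frames E) J L \<and> isotropic E L \<and> higgs_invariant X E L \<and>
        has_degree X (frames E) J L d \<longrightarrow> d \<le> 0)"

definition polystable :: "'a::t2_space chart set \<Rightarrow> ('a, 'n::finite) so_higgs \<Rightarrow> bool" where
  "polystable X E \<longleftrightarrow> semistable X E \<and>
     (\<forall>J L. J \<noteq> {} \<and> subbundle X (frames E) J L \<and> isotropic E L \<and> higgs_invariant X E L \<and>
        has_degree X (frames E) J L 0 \<longrightarrow>
        (\<exists>J' L'. subbundle X (frames E) J' L' \<and> coisotropic E L' \<and> higgs_invariant X E L' \<and>
           (\<forall>x. L x \<inter> L' x = {0} \<and> vec.span (L x \<union> L' x) = UNIV)))"


subsection \<open>The second Stiefel--Whitney class\<close>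

text \<open>For n \<open>\<ge>\<close> 3 the second Stiefel--Whitney class is the obstruction to lifting the structure
  group to the universal cover Spin(n,C), with kernel \<open>\<pi>\<^sub>1(SO(n,C)) = \<int>/2\<close>. It is written here as a
  Cech class. A lift to the universal cover (homotopy classes of paths from the identity) of the
  transition function \<open>g i j\<close> is represented by a homotopy \<open>h i j\<close> in SO(n,C) from the constant
  function 1 to \<open>g i j\<close>. The path \<open>h i j * h j k * inverse (h i k)\<close> is then a loop, and the value
  of the cocycle is its class in \<open>\<pi>\<^sub>1(SO(n,C))\<close>. Covers are indexed by the points of the surface,
  which is no restriction: such covers are cofinal under refinement.\<close>

definition SO_group :: "(complex^'n^'n) set" where
  "SO_group = {A. transpose A ** A = mat 1 \<and> det A = 1}"

definition orthonormal_frame :: "'a::t2_space chart set \<Rightarrow> ('a, 'n::finite) orth_bundle \<Rightarrow>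
    'a set \<Rightarrow> ('a \<Rightarrow> complex^'n^'n) \<Rightarrow> bool" where
  "orthonormal_frame X E S F \<longleftrightarrow> local_frame X (frames E) S F \<and>
     (\<forall>x\<in>S. transpose (F x) ** form E x ** F x = mat 1 \<and> vol E x * det (F x) = 1)"

definition loop_class :: "(real \<Rightarrow> complex^'n^'n) \<Rightarrow> bit" where
  "loop_class p = (if homotopic_paths SO_group p (\<lambda>t. mat 1) then 0 else 1)"

definition w2_cocycle :: "'a::t2_space chart set \<Rightarrow> ('a, 'n::finite) orth_bundle \<Rightarrow>
    ('a \<Rightarrow> 'a set) \<Rightarrow> ('a \<Rightarrow> 'a \<Rightarrow> 'a \<Rightarrow> 'a \<Rightarrow> bit) \<Rightarrow> bool" where
  "w2_cocycle X E U w \<longleftrightarrow> (\<forall>i. i \<in> U i) \<and>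
     (\<exists>F h. (\<forall>i. orthonormal_frame X E (U i) (F i)) \<and>
        (\<forall>i j. continuous_on ((U i \<inter> U j) \<times> {0..1::real}) (h i j) \<and>
           h i j ` ((U i \<inter> U j) \<times> {0..1}) \<subseteq> SO_group \<and>
           (\<forall>x\<in>U i \<inter> U j. h i j (x, 0) = mat 1 \<and> h i j (x, 1) = matrix_inv (F i x) ** F j x)) \<and>
        (\<forall>i j k. \<forall>x\<in>U i \<inter> U j \<inter> U k. w i j k x =
           loop_class (\<lambda>t. h i j (x, t) ** h j k (x, t) ** transpose (h i k (x, t)))))"

definition coboundary ::
  "('a::t2_space \<Rightarrow> 'a set) \<Rightarrow> ('a \<Rightarrow> 'a \<Rightarrow> 'a \<Rightarrow> 'a \<Rightarrow> bit) \<Rightarrow> bool" where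
  "coboundary U w \<longleftrightarrow>
     (\<exists>b :: 'a \<Rightarrow> 'a \<Rightarrow> 'a \<Rightarrow> bit.
        (\<forall>i j. \<forall>x\<in>U i \<inter> U j. \<forall>\<^sub>F y in at x. b i j y = b i j x) \<and>
        (\<forall>i j k. \<forall>x\<in>U i \<inter> U j \<inter> U k. w i j k x = b j k x - b i k x + b i j x))"

definition w2_vanishes :: "'a::t2_space chart set \<Rightarrow> ('a, 'n::finite) orth_bundle \<Rightarrow> bool" where
  "w2_vanishes X E \<longleftrightarrow> (\<exists>U w. w2_cocycle X E U w \<and> coboundary U w)"


section \<open>Higgs bundles for SL(2,C) and the map to SO(4,C)\<close>

record 'a sl2_bundle =
  vframes :: "('a, 2) vbundle"
  omega :: "'a \<Rightarrow> complex^2^2"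

record 'a sl2_higgs = "'a sl2_bundle" +
  phi :: "'a chart \<Rightarrow> 'a \<Rightarrow> complex^2^2"

definition sl2_bundle :: "'a::t2_space chart set \<Rightarrow> ('a, 'z) sl2_bundle_scheme \<Rightarrow> bool" where
  "sl2_bundle X V \<longleftrightarrow> holomorphic_bundle X (vframes V) \<and>
     holomorphic_form X (vframes V) (omega V) \<and>
     (\<forall>x. transpose (omega V x) = - omega V x \<and> invertible (omega V x))"

definition sl2_higgs :: "'a::t2_space chart set \<Rightarrow> 'a sl2_higgs \<Rightarrow> bool" where
  "sl2_higgs X V \<longleftrightarrow> sl2_bundle X V \<and> holomorphic_endo_K X (vframes V) (phi V) \<and>
     (\<forall>c\<in>X. \<forall>x\<in>fst c. trace (phi V c x) = 0)"

text \<open>If \<open>(e, f)\<close> and \<open>(e', f')\<close> are symplectic frames of the factors, the tensor product is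
  oriented by giving \<open>(e \<otimes> e', e \<otimes> f', f \<otimes> e', f \<otimes> f')\<close> volume 1; in arbitrary bases of the
  fibres this is the product of the determinants of the two Gram matrices.\<close>

definition I2 :: "'a sl2_higgs \<Rightarrow> 'a sl2_higgs \<Rightarrow> ('a, 2 \<times> 2) so_higgs" where
  "I2 V1 V2 =
     \<lparr>frames = tensor_bundle (vframes V1) (vframes V2),
      form = (\<lambda>x. kron (omega V1 x) (omega V2 x)),
      vol = (\<lambda>x. det (omega V1 x) * det (omega V2 x)),
      higgs = (\<lambda>c x. kron (phi V1 c x) (mat 1) + kron (mat 1) (phi V2 c x))\<rparr>"

definition neg_higgs :: "'a sl2_higgs \<Rightarrow> 'a sl2_higgs" where
  "neg_higgs V = V\<lparr>phi := (\<lambda>c x. - phi V c x)\<rparr>"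


section \<open>The symmetric square and the exterior square\<close>

text \<open>For a basis \<open>(e, f)\<close> of the fibre, the fibre of the symmetric square has the basis
  \<open>(e \<otimes> e, e \<otimes> f + f \<otimes> e, f \<otimes> f)\<close>. The columns of \<open>sym_incl\<close> are these vectors, \<open>sym_proj\<close> is the
  projection along the antisymmetric tensors, and \<open>sym2_matrix A\<close> is the restriction of \<open>A \<otimes> A\<close>.\<close>

definition sym_incl :: "complex^3^(2 \<times> 2)" where
  "sym_incl = (\<chi> p k. if k = 1 then of_bool (p = (1, 1))
     else if k = 2 then of_bool (p = (1, 2) \<or> p = (2, 1)) else of_bool (p = (2, 2)))"

definition sym_proj :: "complex^(2 \<times> 2)^3" where
  "sym_proj = (\<chi> k p. if k = 1 then of_bool (p = (1, 1))
     else if k = 2 then of_bool (p = (1, 2) \<or> p = (2, 1)) / 2 else of_bool (p = (2, 2)))"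

definition sym2_matrix :: "complex^2^2 \<Rightarrow> complex^3^3" where
  "sym2_matrix A = sym_proj ** kron A A ** sym_incl"

text \<open>The exterior square is trivialized by \<open>e \<otimes> f - f \<otimes> e\<close> for any basis with \<open>\<omega>(e, f) = 1\<close>. In
  terms of the standard basis of the fibre, for which \<open>\<omega>\<close> takes the value w, such a basis is
  obtained by dividing one vector by w.\<close>

definition alt_incl :: "complex \<Rightarrow> complex^1^(2 \<times> 2)" where
  "alt_incl w = (\<chi> p k. if p = (1, 2) then 1 / w else if p = (2, 1) then - (1 / w) else 0)"

text \<open>The quadratic forms are the restrictions of \<open>\<omega> \<otimes> \<omega>\<close>. For a symplectic frame they are 2
  on the exterior square and the matrix with rows (0, 0, 1), (0, -2, 0), (1, 0, 0) on the symmetric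
  square, both of determinant 2; this is the origin of the square roots. The signs are such that
  the identification of the direct sum with \<open>V \<otimes> V\<close> preserves the orientation.\<close>

definition alt2 :: "('a, 'z) sl2_bundle_scheme \<Rightarrow> ('a, 1) orth_bundle" where
  "alt2 V =
     \<lparr>frames = trivial_line,
      form = (\<lambda>x. transpose (alt_incl (omega V x $ 1 $ 2)) ** kron (omega V x) (omega V x)
                    ** alt_incl (omega V x $ 1 $ 2)),
      vol = (\<lambda>x. of_real (sqrt 2))\<rparr>"

definition sym2 :: "('a, 'z) sl2_bundle_scheme \<Rightarrow> ('a, 3) orth_bundle" where
  "sym2 V =
     \<lparr>frames = {(S, \<lambda>x. sym2_matrix (F x)) | S F. (S, F) \<in> vframes V},
      form = (\<lambda>x. transpose sym_incl ** kron (omega V x) (omega V x) ** sym_incl),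
      vol = (\<lambda>x. - of_real (sqrt 2) * (omega V x $ 1 $ 2) ^ 3)\<rparr>"

definition alt_sym_map :: "('a, 'z) sl2_bundle_scheme \<Rightarrow> 'a \<Rightarrow> complex^(1 + 3)^(2 \<times> 2)" where
  "alt_sym_map V x = (\<chi> p q. case q of
       Inl k \<Rightarrow> alt_incl (omega V x $ 1 $ 2) $ p $ k | Inr k \<Rightarrow> sym_incl $ p $ k)"

text \<open>The bijection preserving the lexicographic orders of the two index types.\<close>

definition index_map :: "1 + 3 \<Rightarrow> 2 \<times> 2" where
  "index_map q = (case q of Inl k \<Rightarrow> (1, 1)
     | Inr k \<Rightarrow> if k = 1 then (1, 2) else if k = 2 then (2, 1) else (2, 2))"


section \<open>Higgs bundles for SO_0(1,3)\<close>

record 'a so13_higgs =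
  O13 :: "('a, 1) orth_bundle"
  W13 :: "('a, 3) orth_bundle"
  beta :: "'a chart \<Rightarrow> 'a \<Rightarrow> complex^3^1"

definition so13_higgs :: "'a::t2_space chart set \<Rightarrow> 'a so13_higgs \<Rightarrow> bool" where
  "so13_higgs X P \<longleftrightarrow>
     frames (O13 P) = trivial_line \<and> orth_bundle X (O13 P) \<and> orth_bundle X (W13 P) \<and>
     canonical_valued X (beta P) \<and>
     (\<forall>(S, F)\<in>frames (W13 P). \<forall>c\<in>X. matrix_holo_on X (S \<inter> fst c) (\<lambda>x. beta P c x ** F x))"

definition orth_transpose ::
  "complex^1^1 \<Rightarrow> complex^3^3 \<Rightarrow> complex^3^1 \<Rightarrow> complex^1^3" where
  "orth_transpose q1 q3 b = matrix_inv q3 ** transpose b ** q1"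

definition so13_to_so4 :: "'a so13_higgs \<Rightarrow> ('a, 1 + 3) so_higgs" where
  "so13_to_so4 P =
     \<lparr>frames = sum_bundle (frames (O13 P)) (frames (W13 P)),
      form = (\<lambda>x. block (form (O13 P) x) 0 0 (form (W13 P) x)),
      vol = (\<lambda>x. vol (O13 P) x * vol (W13 P) x),
      higgs = (\<lambda>c x. block 0 (beta P c x)
        (- orth_transpose (form (O13 P) x) (form (W13 P) x) (beta P c x)) 0)\<rparr>"

text \<open>Points of the moduli space are represented by the polystable Higgs bundles; polystability
  of an SO_0(1,3)-Higgs bundle is that of the associated SO(4,C)-Higgs bundle.\<close>

definition represents_point_of_M_plus_SO13 ::
  "'a::t2_space chart set \<Rightarrow> 'a so13_higgs \<Rightarrow> bool" where
  "represents_point_of_M_plus_SO13 X P \<longleftrightarrow>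
     so13_higgs X P \<and> polystable X (so13_to_so4 P) \<and> w2_vanishes X (W13 P)"

end

theory Submission
  imports Defs
begin

text \<open>The first half is linear algebra on each fibre. The operator \<open>\<phi> \<otimes> 1 - 1 \<otimes> \<phi>\<close> on \<open>V \<otimes> V\<close> changes
sign when the two factors are exchanged. It therefore maps symmetric tensors to alternating ones
and conversely, and its matrix for the splitting of \<open>V \<otimes> V\<close> into \<open>\<Lambda>\<^sup>2V\<close> and \<open>Sym\<^sup>2V\<close> has zero
diagonal blocks. One block is \<open>\<beta>\<close>, computed in \<open>tensor_higgs_sym\<close>; the other is \<open>-\<beta>\<^sup>T\<close> because the
operator is skew for \<open>\<omega> \<otimes> \<omega>\<close> (\<open>tensor_higgs_alt\<close>). Holomorphy of all the data, and the formula for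
\<open>\<beta>\<close> in symplectic frames, follow from the behaviour of these matrices under a change of frame
(\<open>kron_sym_incl\<close>, \<open>kron_alt_incl\<close>, \<open>beta_row_sym2\<close>).

The second half is the existence of spin structures. In an orthonormal basis the symmetric square
is a homomorphism \<open>spin\<close> from SL(2,C) to SO(3,C), and it is a covering map with kernel
\<open>{1, -1}\<close> whose total space is simply connected (\<open>spin_covering\<close>, \<open>SL2_simply_connected\<close>). The
orthogonal bundle W has orthonormal frames with transition functions in SO(3,C), and the data of
a second Stiefel--Whitney cocycle contain a path from the identity to each of their values. Lifting
these paths to SL(2,C) gives lifts of the transition functions. The lifts satisfy the cocycle
condition up to signs, and these signs are precisely the cocycle (\<open>spin_end_mult\<close>): a loop in
SO(3,C) is contractible if and only if its lift is closed. If the class vanishes, a change of signs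
turns the lifts into a cocycle (\<open>spin_cocycle\<close>), which is holomorphic because \<open>spin\<close> has
holomorphic local inverses (\<open>spin_lift_holomorphic\<close>). The rank two bundle with these transition
functions is the required V, and the frames of W identify W with \<open>Sym\<^sup>2V\<close>
(\<open>spinor_bundle_sym2_iso\<close>).\<close>

(* The dollar sign denotes the entries of vectors and matrices only, not the coefficients of
   formal power series. *)
no_notation fps_nth (infixl \<open>$\<close> 75)

section \<open>Matrices over small index types\<close>

lemma UNIV_prod_2: "(UNIV :: (2 \<times> 2) set) = {(1,1), (1,2), (2,1), (2,2)}"
proof -
  have "(UNIV :: (2 \<times> 2) set) = {1, 2} \<times> {1, 2}"
    by (simp only: UNIV_2[symmetric] UNIV_Times_UNIV)
  then show ?thesis by auto
qed

lemma UNIV_sum_1_3: "(UNIV :: (1 + 3) set) = {Inl 1, Inr 1, Inr 2, Inr 3}"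
proof -
  have "(UNIV :: (1 + 3) set) = Inl ` {1} \<union> Inr ` {1, 2, 3}"
    by (simp only: UNIV_3[symmetric] UNIV_1[symmetric] UNIV_sum)
  then show ?thesis by auto
qed

lemma forall_prod_2: "(\<forall>p::2 \<times> 2. P p) \<longleftrightarrow> P (1,1) \<and> P (1,2) \<and> P (2,1) \<and> P (2,2)"
  by (simp only: split_paired_All forall_2 conj_assoc)

lemma forall_sum_1_3: "(\<forall>p::1 + 3. P p) \<longleftrightarrow> P (Inl 1) \<and> P (Inr 1) \<and> P (Inr 2) \<and> P (Inr 3)"
  by (simp only: split_sum_all forall_1 forall_3)

lemma sum_prod_2: "sum f (UNIV :: (2 \<times> 2) set) = f (1,1) + f (1,2) + f (2,1) + f (2,2)"
  unfolding UNIV_prod_2 by (simp add: add.assoc)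

lemma sum_sum_1_3:
  "sum f (UNIV :: (1 + 3) set) = f (Inl 1) + f (Inr 1) + f (Inr 2) + f (Inr 3)"
  unfolding UNIV_sum_1_3 by (simp add: add.assoc)

text \<open>Rewriting with these rules turns an identity between explicitly given matrices into a finite
list of identities between their entries.\<close>

lemmas mat_entries = vec_eq_iff matrix_matrix_mult_def transpose_def mat_def kron_def block_def
  forall_1 forall_2 forall_3 forall_prod_2 forall_sum_1_3
  sum_1 sum_2 sum_3 sum_prod_2 sum_sum_1_3

text \<open>Laplace expansion along the row a. The index types \<open>2 \<times> 2\<close> and \<open>1 + 3\<close> both have four elements
and neither is the numeral type 4, so the expansion is stated for an arbitrary enumeration of the
indices.\<close>

lemma det_4_elements:
  fixes A :: "'c::comm_ring_1^'n^'n"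
  assumes U: "(UNIV :: 'n set) = {a, b, c, d}" and D: "distinct [a, b, c, d]"
  shows "det A =
     A$a$a * (A$b$b * (A$c$c * A$d$d - A$c$d * A$d$c) - A$b$c * (A$c$b * A$d$d - A$c$d * A$d$b)
        + A$b$d * (A$c$b * A$d$c - A$c$c * A$d$b))
   - A$a$b * (A$b$a * (A$c$c * A$d$d - A$c$d * A$d$c) - A$b$c * (A$c$a * A$d$d - A$c$d * A$d$a)
        + A$b$d * (A$c$a * A$d$c - A$c$c * A$d$a))
   + A$a$c * (A$b$a * (A$c$b * A$d$d - A$c$d * A$d$b) - A$b$b * (A$c$a * A$d$d - A$c$d * A$d$a)
        + A$b$d * (A$c$a * A$d$b - A$c$b * A$d$a))
   - A$a$d * (A$b$a * (A$c$b * A$d$c - A$c$c * A$d$b) - A$b$b * (A$c$a * A$d$c - A$c$c * A$d$a)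
        + A$b$c * (A$c$a * A$d$b - A$c$b * A$d$a))"
proof -
  have ne: "a \<noteq> b" "a \<noteq> c" "a \<noteq> d" "b \<noteq> c" "b \<noteq> d" "c \<noteq> d"
     "b \<noteq> a" "c \<noteq> a" "d \<noteq> a" "c \<noteq> b" "d \<noteq> b" "d \<noteq> c"
    using D by auto
  have f1: "finite {b, c, d}" "a \<notin> {b, c, d}" using ne by auto
  have f2: "finite {c, d}" "b \<notin> {c, d}" using ne by auto
  have f3: "finite {d}" "c \<notin> {d}" using ne by auto
  show ?thesis
    unfolding det_def U
    unfolding sum_over_permutations_insert[OF f1]
    unfolding sum_over_permutations_insert[OF f2]
    unfolding sum_over_permutations_insert[OF f3]
    unfolding permutes_sing
    by (simp add: ne sign_swap_id permutation_swap_id sign_compose sign_id swap_id_eq permutation_compose)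
       (simp add: algebra_simps)
qed

lemma kron_mult: "kron A B ** kron C D = kron (A ** C) (B ** D)"
  unfolding kron_def matrix_matrix_mult_def
  by (auto simp: vec_eq_iff sum_product sum.cartesian_product UNIV_Times_UNIV[symmetric] algebra_simps
      intro!: sum.cong simp del: UNIV_Times_UNIV)

lemma kron_mat_1: "kron (mat 1) (mat 1) = mat 1"
  by (auto simp: kron_def mat_def vec_eq_iff)

lemma transpose_kron: "transpose (kron A B) = kron (transpose A) (transpose B)"
  by (auto simp: kron_def transpose_def vec_eq_iff)

text \<open>The two factors of \<open>(A \<otimes> 1)(1 \<otimes> B)\<close> are, up to a permutation of the basis, block diagonal with
two equal blocks.\<close>

lemma det_kron:
  fixes A B :: "complex^2^2"
  shows "det (kron A B) = (det A)\<^sup>2 * (det B)\<^sup>2"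
proof -
  have 1: "det (kron A (mat 1 :: complex^2^2)) = (det A)\<^sup>2"
    unfolding det_4_elements[OF UNIV_prod_2, simplified] det_2
    by (simp add: kron_def mat_def power2_eq_square algebra_simps)
  have 2: "det (kron (mat 1 :: complex^2^2) B) = (det B)\<^sup>2"
    unfolding det_4_elements[OF UNIV_prod_2, simplified] det_2
    by (simp add: kron_def mat_def power2_eq_square algebra_simps)
  have "kron A B = kron A (mat 1) ** kron (mat 1) B" by (simp add: kron_mult)
  then show ?thesis by (simp only: det_mul 1 2)
qed

lemma matrix_inv_mult:
  fixes A :: "complex^'n^'m" assumes "invertible A"
  shows "A ** matrix_inv A = mat 1" "matrix_inv A ** A = mat 1"
  using someI_ex[OF assms[unfolded invertible_def]] unfolding matrix_inv_def by auto

lemma matrix_inv_unique: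
  fixes A :: "complex^'n^'m" assumes "A ** B = mat 1" "B ** A = mat 1"
  shows "matrix_inv A = B" "invertible A"
proof -
  show inv: "invertible A" using assms unfolding invertible_def by blast
  have "matrix_inv A = matrix_inv A ** (A ** B)" using assms by simp
  also have "\<dots> = B" unfolding matrix_mul_assoc matrix_inv_mult(2)[OF inv] by simp
  finally show "matrix_inv A = B" .
qed

lemma kron_inv:
  assumes "invertible A" "invertible B"
  shows "matrix_inv (kron A B) = kron (matrix_inv A) (matrix_inv B)" "invertible (kron A B)"
proof -
  have 1: "kron A B ** kron (matrix_inv A) (matrix_inv B) = mat 1"
    "kron (matrix_inv A) (matrix_inv B) ** kron A B = mat 1"
    by (simp_all add: kron_mult matrix_inv_mult assms kron_mat_1)
  show "matrix_inv (kron A B) = kron (matrix_inv A) (matrix_inv B)" "invertible (kron A B)"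
    using matrix_inv_unique[OF 1] by auto
qed

section \<open>The symmetric and the exterior square of a plane\<close>

lemma sym2_matrix_entries:
  "sym2_matrix A = vector [
     vector [(A$1$1)\<^sup>2, 2 * A$1$1 * A$1$2, (A$1$2)\<^sup>2],
     vector [A$1$1 * A$2$1, A$1$1 * A$2$2 + A$1$2 * A$2$1, A$1$2 * A$2$2],
     vector [(A$2$1)\<^sup>2, 2 * A$2$1 * A$2$2, (A$2$2)\<^sup>2]]"
  unfolding sym2_matrix_def sym_proj_def sym_incl_def
  by (simp add: mat_entries vector_3 power2_eq_square algebra_simps)

text \<open>Symmetric tensors are stable under \<open>A \<otimes> A\<close>. This is what makes \<open>sym2_matrix\<close>, defined through
the projection to the symmetric tensors, multiplicative.\<close>

lemma kron_sym_incl: "kron A A ** sym_incl = sym_incl ** sym2_matrix A"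
  unfolding sym2_matrix_entries sym_incl_def
  by (simp add: mat_entries vector_3 power2_eq_square algebra_simps)

lemma sym_proj_incl: "sym_proj ** sym_incl = mat 1"
  unfolding sym_proj_def sym_incl_def by (simp add: mat_entries)

lemma sym2_matrix_mult: "sym2_matrix (A ** B) = sym2_matrix A ** sym2_matrix B"
proof -
  have "sym2_matrix (A ** B) = sym_proj ** ((kron A A ** kron B B) ** sym_incl)"
    unfolding sym2_matrix_def kron_mult by (simp add: matrix_mul_assoc)
  also have "\<dots> = (sym_proj ** kron A A) ** (kron B B ** sym_incl)"
    by (simp only: matrix_mul_assoc)
  also have "\<dots> = (sym_proj ** kron A A) ** (sym_incl ** sym2_matrix B)"
    by (simp only: kron_sym_incl)
  also have "\<dots> = sym2_matrix A ** sym2_matrix B"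
    by (simp only: sym2_matrix_def matrix_mul_assoc)
  finally show ?thesis .
qed

lemma sym2_matrix_1: "sym2_matrix (mat 1) = mat 1"
  unfolding sym2_matrix_def kron_mat_1 by (simp add: sym_proj_incl)

lemma det_sym2_matrix: "det (sym2_matrix A) = (det A) ^ 3"
  unfolding det_3 det_2 sym2_matrix_entries
  by (simp add: vector_3 power2_eq_square power3_eq_cube algebra_simps)

lemma sym2_matrix_inv:
  assumes "invertible A"
  shows "matrix_inv (sym2_matrix A) = sym2_matrix (matrix_inv A)" "invertible (sym2_matrix A)"
  using matrix_inv_unique[of "sym2_matrix A" "sym2_matrix (matrix_inv A)"]
  by (simp_all add: sym2_matrix_mult[symmetric] matrix_inv_mult assms sym2_matrix_1)

lemma kron_alt:
  "kron A A ** (\<chi> p k. if p = (1, 2) then q else if p = (2, 1) then - q else 0 :: complex^1^(2 \<times> 2))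
    = (\<chi> p k. if p = (1, 2) then q * det A else if p = (2, 1) then - (q * det A) else 0)"
  by (simp add: mat_entries det_2 algebra_simps)

text \<open>In a frame A the form \<open>\<omega>\<close> takes the value \<open>w det A\<close> instead of w, and \<open>A \<otimes> A\<close> multiplies
\<open>e \<otimes> f - f \<otimes> e\<close> by \<open>det A\<close>. Hence the generator of the exterior square that is normalized by \<open>\<omega>\<close> is
the same in all frames.\<close>

lemma kron_alt_incl:
  assumes "det A \<noteq> 0"
  shows "kron A A ** alt_incl (w * det A) = alt_incl w"
proof -
  have "1 / (w * det A) * det A = 1 / w" using assms by simp
  then show ?thesis unfolding alt_incl_def kron_alt by (simp only:)
qed

lemma skew_entries:
  fixes M :: "complex^2^2" assumes "transpose M = - M"
  shows "M$1$1 = 0" "M$2$2 = 0" "M$2$1 = - M$1$2"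
proof -
  have *: "M$j$i = - M$i$j" for i j
    using arg_cong[OF assms, of "\<lambda>N. N$i$j"] by (simp add: transpose_def)
  show "M$1$1 = 0" "M$2$2 = 0" using *[of 1 1] *[of 2 2] by simp_all
  show "M$2$1 = - M$1$2" using * .
qed

text \<open>Alternating forms on a plane are multiplied by the determinant under a change of basis. For a
holomorphic symplectic form M and a holomorphic frame F this shows that the function
\<open>M\<^sub>1\<^sub>2 det F\<close> is holomorphic, although its factors depend on the identification of the fibres with
the standard plane, which varies without any continuity.\<close>

lemma congruence_skew:
  fixes M F :: "complex^2^2" assumes "transpose M = - M"
  shows "(transpose F ** M ** F)$1$2 = M$1$2 * det F"
  using skew_entries[OF assms] by (simp add: mat_entries det_2 algebra_simps)

text \<open>The map from \<open>Sym\<^sup>2V\<close> to \<open>\<Lambda>\<^sup>2V\<close> induced by \<open>A \<otimes> 1 - 1 \<otimes> A\<close>, in the standard basis of a fibre on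
which \<open>\<omega>\<close> takes the value w. For \<open>w = 1\<close> and A with rows (a, b) and (c, -a) it is (-c, 2a, b).\<close>

definition beta_row :: "complex \<Rightarrow> complex^2^2 \<Rightarrow> complex^3^1" where
  "beta_row w A = vector [vector [- w * A$2$1, w * (A$1$1 - A$2$2), w * A$1$2]]"

text \<open>If A becomes B in the frame F, then the row of A becomes the row of B in the frame induced by F on
the symmetric square, with w replaced by the value of \<open>\<omega>\<close> on the frame. Both the holomorphy of \<open>\<beta>\<close>
and its shape in symplectic frames are instances of this.\<close>

lemma beta_row_sym2:
  assumes "A ** F = F ** B"
  shows "beta_row w A ** sym2_matrix F = beta_row (w * det F) B"
proof -
  have e: "A$1$1 * F$1$1 + A$1$2 * F$2$1 = F$1$1 * B$1$1 + F$1$2 * B$2$1"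
    "A$1$1 * F$1$2 + A$1$2 * F$2$2 = F$1$1 * B$1$2 + F$1$2 * B$2$2"
    "A$2$1 * F$1$1 + A$2$2 * F$2$1 = F$2$1 * B$1$1 + F$2$2 * B$2$1"
    "A$2$1 * F$1$2 + A$2$2 * F$2$2 = F$2$1 * B$1$2 + F$2$2 * B$2$2"
    using assms by (simp_all add: mat_entries)
  have "- (A$2$1 * (F$1$1)\<^sup>2) + (A$1$1 - A$2$2) * (F$1$1 * F$2$1) + A$1$2 * (F$2$1)\<^sup>2
      = F$2$1 * (A$1$1 * F$1$1 + A$1$2 * F$2$1) - F$1$1 * (A$2$1 * F$1$1 + A$2$2 * F$2$1)"
    by (simp add: power2_eq_square algebra_simps)
  also have "\<dots> = - (det F * B$2$1)"
    unfolding e det_2 by (simp add: algebra_simps)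
  finally have 1: "- (A$2$1 * (F$1$1)\<^sup>2) + (A$1$1 - A$2$2) * (F$1$1 * F$2$1) + A$1$2 * (F$2$1)\<^sup>2
      = - (det F * B$2$1)" .
  have "- (A$2$1 * (2 * F$1$1 * F$1$2)) + (A$1$1 - A$2$2) * (F$1$1 * F$2$2 + F$1$2 * F$2$1)
      + A$1$2 * (2 * F$2$1 * F$2$2)
      = F$2$2 * (A$1$1 * F$1$1 + A$1$2 * F$2$1) + F$2$1 * (A$1$1 * F$1$2 + A$1$2 * F$2$2)
        - F$1$2 * (A$2$1 * F$1$1 + A$2$2 * F$2$1) - F$1$1 * (A$2$1 * F$1$2 + A$2$2 * F$2$2)"
    by (simp add: algebra_simps)
  also have "\<dots> = det F * (B$1$1 - B$2$2)"
    unfolding e det_2 by (simp add: algebra_simps)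
  finally have 2: "- (A$2$1 * (2 * F$1$1 * F$1$2)) + (A$1$1 - A$2$2) * (F$1$1 * F$2$2 + F$1$2 * F$2$1)
      + A$1$2 * (2 * F$2$1 * F$2$2) = det F * (B$1$1 - B$2$2)" .
  have "- (A$2$1 * (F$1$2)\<^sup>2) + (A$1$1 - A$2$2) * (F$1$2 * F$2$2) + A$1$2 * (F$2$2)\<^sup>2
      = F$2$2 * (A$1$1 * F$1$2 + A$1$2 * F$2$2) - F$1$2 * (A$2$1 * F$1$2 + A$2$2 * F$2$2)"
    by (simp add: power2_eq_square algebra_simps)
  also have "\<dots> = det F * B$1$2"
    unfolding e det_2 by (simp add: algebra_simps)
  finally have 3: "- (A$2$1 * (F$1$2)\<^sup>2) + (A$1$1 - A$2$2) * (F$1$2 * F$2$2) + A$1$2 * (F$2$2)\<^sup>2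
      = det F * B$1$2" .
  note 123 = arg_cong[OF 1, of "(*) w"] arg_cong[OF 2, of "(*) w"] arg_cong[OF 3, of "(*) w"]
  show ?thesis
    unfolding beta_row_def sym2_matrix_entries
    using 123 by (simp add: mat_entries vector_3 vector_1 algebra_simps)
qed

lemma sum_UNIV_sum: "sum f (UNIV :: ('n::finite + 'm::finite) set) = (\<Sum>i\<in>UNIV. f (Inl i)) + (\<Sum>i\<in>UNIV. f (Inr i))"
  by (simp add: UNIV_Plus_UNIV[symmetric] sum.Plus del: UNIV_Plus_UNIV)

text \<open>The linear map out of a direct sum with given restrictions to the two summands.\<close>

definition hcat :: "complex^'n^'p \<Rightarrow> complex^'m^'p \<Rightarrow> complex^('n + 'm)^'p" where
  "hcat A B = (\<chi> p q. case q of Inl k \<Rightarrow> A $ p $ k | Inr k \<Rightarrow> B $ p $ k)"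

lemma mult_hcat: "M ** hcat A B = hcat (M ** A) (M ** B)"
  by (simp add: hcat_def matrix_matrix_mult_def vec_eq_iff split_sum_all)

lemma hcat_mult_block: "hcat A B ** block P Q R S = hcat (A ** P + B ** R) (A ** Q + B ** S)"
  by (simp add: hcat_def block_def matrix_matrix_mult_def vec_eq_iff split_sum_all sum_UNIV_sum)

lemma hcat_gram: "transpose (hcat A B) ** M ** hcat A B
   = block (transpose A ** M ** A) (transpose A ** M ** B) (transpose B ** M ** A) (transpose B ** M ** B)"
  by (simp add: hcat_def block_def transpose_def matrix_matrix_mult_def vec_eq_iff split_sum_all)

lemma kron_add_left: "kron (A + B) C = kron A C + kron B C"
  by (simp add: kron_def vec_eq_iff algebra_simps)

lemma kron_add_right: "kron A (B + C) = kron A B + kron A C"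
  by (simp add: kron_def vec_eq_iff algebra_simps)

lemma kron_0: "kron 0 A = 0" "kron A 0 = 0"
  by (simp_all add: kron_def vec_eq_iff)

text \<open>Tracefree endomorphisms of a plane form the Lie algebra of its symplectic group.\<close>

lemma tracefree_skew:
  fixes A M :: "complex^2^2"
  assumes M: "transpose M = - M" and A: "trace A = 0"
  shows "transpose A ** M + M ** A = 0"
proof -
  have "A$2$2 = - A$1$1" using A by (simp add: trace_def sum_2 add_eq_0_iff)
  then show ?thesis using skew_entries[OF M] by (simp add: mat_entries)
qed

text \<open>The Gram matrix of \<open>\<omega> \<otimes> \<omega>\<close> on the symmetric tensors when \<open>\<omega>\<close> takes the value w on the standard
basis.\<close>

definition sym_form :: "complex \<Rightarrow> complex^3^3" where
  "sym_form w = vector [vector [0, 0, w\<^sup>2], vector [0, - 2 * w\<^sup>2, 0], vector [w\<^sup>2, 0, 0]]"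

lemma sym_incl_gram:
  assumes "transpose M = - M"
  shows "transpose sym_incl ** kron M M ** sym_incl = sym_form (M$1$2)"
  using skew_entries[OF assms] unfolding sym_form_def sym_incl_def
  by (simp add: mat_entries vector_3 power2_eq_square)

lemma alt_incl_gram:
  assumes "transpose M = - M" "M$1$2 \<noteq> 0"
  shows "transpose (alt_incl (M$1$2)) ** kron M M ** alt_incl (M$1$2) = mat 2"
  using skew_entries[OF assms(1)] assms(2) unfolding alt_incl_def
  by (simp add: mat_entries)

lemma alt_sym_orthogonal:
  assumes "transpose M = - M"
  shows "transpose (alt_incl w) ** kron M M ** sym_incl = 0"
    "transpose sym_incl ** kron M M ** alt_incl w = 0"
  using skew_entries[OF assms] unfolding alt_incl_def sym_incl_def
  by (simp_all add: mat_entries)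

lemma sym_form_inv:
  assumes "w \<noteq> 0"
  shows "matrix_inv (sym_form w) = vector [vector [0, 0, 1 / w\<^sup>2], vector [0, - 1 / (2 * w\<^sup>2), 0], vector [1 / w\<^sup>2, 0, 0]]"
   "invertible (sym_form w)"
proof -
  let ?B = "vector [vector [0, 0, 1 / w\<^sup>2], vector [0, - 1 / (2 * w\<^sup>2), 0], vector [1 / w\<^sup>2, 0, 0]] :: complex^3^3"
  have "sym_form w ** ?B = mat 1" "?B ** sym_form w = mat 1"
    using assms by (simp_all add: sym_form_def mat_entries vector_3)
  then show "matrix_inv (sym_form w) = ?B" "invertible (sym_form w)"
    using matrix_inv_unique by blast+
qed

lemma det_sym_form: "det (sym_form w) = 2 * w ^ 6"
  by (simp add: det_3 sym_form_def vector_3 eval_nat_numeral)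

lemma transpose_sym_form: "transpose (sym_form w) = sym_form w"
  by (simp add: sym_form_def mat_entries vector_3)

text \<open>The Higgs field \<open>A \<otimes> 1 + 1 \<otimes> (-A)\<close> on \<open>V \<otimes> V\<close>. It anticommutes with the exchange of the two
factors, hence it exchanges symmetric and alternating tensors.\<close>

definition tensor_higgs :: "complex^2^2 \<Rightarrow> complex^(2 \<times> 2)^(2 \<times> 2)" where
  "tensor_higgs A = kron A (mat 1) + kron (mat 1) (- A)"

lemma tensor_higgs_sym:
  assumes "w \<noteq> 0"
  shows "tensor_higgs A ** sym_incl = alt_incl w ** beta_row w A"
  using assms unfolding tensor_higgs_def sym_incl_def alt_incl_def beta_row_def
  by (simp add: mat_entries vector_3 vector_1)

text \<open>The operator is skew for \<open>\<omega> \<otimes> \<omega>\<close>, so this block is minus the adjoint of the one in the previous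
lemma.\<close>

lemma tensor_higgs_alt:
  assumes w: "w \<noteq> 0" and A: "trace A = 0"
  shows "tensor_higgs A ** alt_incl w = sym_incl ** (- orth_transpose (mat 2) (sym_form w) (beta_row w A))"
proof -
  have "A$2$2 = - A$1$1" using A by (simp add: trace_def sum_2 add_eq_0_iff)
  then show ?thesis using w unfolding tensor_higgs_def sym_incl_def alt_incl_def beta_row_def
     orth_transpose_def sym_form_inv(1)[OF w]
    by (simp add: mat_entries vector_3 vector_1 power2_eq_square)
qed

text \<open>The identification of the direct sum of \<open>\<Lambda>\<^sup>2V\<close> and \<open>Sym\<^sup>2V\<close> with \<open>V \<otimes> V\<close> on a fibre.\<close>

definition alt_sym :: "complex \<Rightarrow> complex^(1 + 3)^(2 \<times> 2)" where
  "alt_sym w = hcat (alt_incl w) sym_incl"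

text \<open>In the frames induced by a frame F of V, the identification is again given by \<open>alt_sym\<close>, for the value
of \<open>\<omega>\<close> on F. As this value is holomorphic, so is the identification.\<close>

lemma alt_sym_block:
  assumes "det F \<noteq> 0"
  shows "alt_sym w ** block (mat 1) 0 0 (sym2_matrix F) = kron F F ** alt_sym (w * det F)"
  unfolding alt_sym_def hcat_mult_block mult_hcat kron_alt_incl[OF assms] kron_sym_incl by simp

lemma invertible_alt_sym:
  assumes "w \<noteq> 0" shows "invertible (alt_sym w)"
proof (rule matrix_inv_unique(2))
  define S :: "complex^(2 \<times> 2)^(1 + 3)" where
    "S = (\<chi> q p. case q of Inl k \<Rightarrow> (if p = (1, 2) then w / 2 else if p = (2, 1) then - w / 2 else 0)
        | Inr k \<Rightarrow> sym_proj $ k $ p)"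
  show "alt_sym w ** S = mat 1" "S ** alt_sym w = mat 1"
    using assms unfolding S_def alt_sym_def hcat_def alt_incl_def sym_incl_def sym_proj_def
    by (simp_all add: mat_entries)
qed

text \<open>The value fits the volume forms: they are \<open>-2 w\<^sup>3\<close> on the direct sum and \<open>w\<^sup>4\<close> on \<open>V \<otimes> V\<close>.\<close>

lemma det_alt_sym:
  assumes "w \<noteq> 0"
  shows "det (\<chi> i j. alt_sym w $ index_map i $ j) = - 2 / w"
  unfolding det_4_elements[OF UNIV_sum_1_3, simplified]
  by (simp add: alt_sym_def hcat_def alt_incl_def sym_incl_def index_map_def)

lemma bij_index_map: "bij index_map"
proof (rule bijI)
  show "surj index_map"
    unfolding surj_def forall_prod_2
    by (auto simp: index_map_def intro: exI[of _ "Inl 1"] exI[of _ "Inr 1"] exI[of _ "Inr 2"] exI[of _ "Inr 3"])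
  show "inj index_map"
    unfolding inj_def forall_sum_1_3 by (simp add: index_map_def)
qed

section \<open>Holomorphic matrices on a Riemann surface\<close>

lemma chart_inv_coordinate:
  assumes "riemann_surface X" "c \<in> X" "x \<in> fst c"
  shows "chart_inv c (snd c x) = x"
  using assms unfolding riemann_surface_def homeomorphism_def by auto

lemma holo_on_cong:
  assumes "riemann_surface X" "\<And>x. x \<in> S \<Longrightarrow> f x = g x"
  shows "holo_on X S f \<longleftrightarrow> holo_on X S g"
  unfolding holo_on_def
proof (rule ball_cong[OF refl])
  fix c assume "c \<in> X"
  then show "((f \<circ> chart_inv c) holomorphic_on snd c ` (fst c \<inter> S)) =
         ((g \<circ> chart_inv c) holomorphic_on snd c ` (fst c \<inter> S))"
    by (intro holomorphic_cong) (auto simp: chart_inv_coordinate[OF assms(1)] assms(2))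
qed

lemma holo_on_subset: "holo_on X T f \<Longrightarrow> S \<subseteq> T \<Longrightarrow> holo_on X S f"
  unfolding holo_on_def by (meson Int_mono holomorphic_on_subset image_mono order_refl)

lemma holo_on_const: "holo_on X S (\<lambda>x. a)"
  unfolding holo_on_def o_def by simp

lemma holo_on_add: "holo_on X S f \<Longrightarrow> holo_on X S g \<Longrightarrow> holo_on X S (\<lambda>x. f x + g x)"
  unfolding holo_on_def o_def by (auto intro: holomorphic_intros)

lemma holo_on_diff: "holo_on X S f \<Longrightarrow> holo_on X S g \<Longrightarrow> holo_on X S (\<lambda>x. f x - g x)"
  unfolding holo_on_def o_def by (auto intro: holomorphic_intros)

lemma holo_on_minus: "holo_on X S f \<Longrightarrow> holo_on X S (\<lambda>x. - f x)"
  unfolding holo_on_def o_def by (auto intro: holomorphic_intros)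

lemma holo_on_mult: "holo_on X S f \<Longrightarrow> holo_on X S g \<Longrightarrow> holo_on X S (\<lambda>x. f x * g x)"
  unfolding holo_on_def o_def by (auto intro: holomorphic_intros)

lemma holo_on_power: "holo_on X S f \<Longrightarrow> holo_on X S (\<lambda>x. f x ^ n)"
  unfolding holo_on_def o_def by (auto intro: holomorphic_intros)

lemma holo_on_sum: "(\<And>i. i \<in> I \<Longrightarrow> holo_on X S (f i)) \<Longrightarrow> holo_on X S (\<lambda>x. \<Sum>i\<in>I. f i x)"
  unfolding holo_on_def o_def by (intro ballI holomorphic_on_sum) blast

lemma holo_on_divide:
  assumes "riemann_surface X" "holo_on X S f" "holo_on X S g" "\<And>x. x \<in> S \<Longrightarrow> g x \<noteq> 0"
  shows "holo_on X S (\<lambda>x. f x / g x)"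
  unfolding holo_on_def o_def
proof (intro ballI holomorphic_on_divide)
  fix c assume c: "c \<in> X"
  show "(\<lambda>z. f (chart_inv c z)) holomorphic_on snd c ` (fst c \<inter> S)"
    "(\<lambda>z. g (chart_inv c z)) holomorphic_on snd c ` (fst c \<inter> S)"
    using assms(2,3) c unfolding holo_on_def o_def by blast+
  show "g (chart_inv c z) \<noteq> 0" if "z \<in> snd c ` (fst c \<inter> S)" for z
    using that assms(4) chart_inv_coordinate[OF assms(1) c] by auto
qed

lemmas holo_intros = holo_on_const holo_on_add holo_on_diff holo_on_minus holo_on_mult
  holo_on_power holo_on_sum

lemma matrix_holo_entry: "matrix_holo_on X S A \<Longrightarrow> holo_on X S (\<lambda>x. A x $ i $ j)"
  unfolding matrix_holo_on_def by blast

lemma matrix_holo_cong: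
  assumes "riemann_surface X" "\<And>x. x \<in> S \<Longrightarrow> A x = B x"
  shows "matrix_holo_on X S A \<longleftrightarrow> matrix_holo_on X S B"
  unfolding matrix_holo_on_def
  using holo_on_cong[OF assms(1), of S "\<lambda>x. A x $ i $ j" "\<lambda>x. B x $ i $ j" for i j] assms(2) by simp

lemma matrix_holo_subset: "matrix_holo_on X T A \<Longrightarrow> S \<subseteq> T \<Longrightarrow> matrix_holo_on X S A"
  unfolding matrix_holo_on_def using holo_on_subset by blast

lemma matrix_holo_const: "matrix_holo_on X S (\<lambda>x. A)"
  by (simp add: matrix_holo_on_def holo_on_const)

lemma matrix_holo_mult:
  "matrix_holo_on X S A \<Longrightarrow> matrix_holo_on X S B \<Longrightarrow> matrix_holo_on X S (\<lambda>x. A x ** B x)"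
  by (auto simp: matrix_holo_on_def matrix_matrix_mult_def intro!: holo_intros)

lemma matrix_holo_add:
  "matrix_holo_on X S A \<Longrightarrow> matrix_holo_on X S B \<Longrightarrow> matrix_holo_on X S (\<lambda>x. A x + B x)"
  by (auto simp: matrix_holo_on_def intro!: holo_intros)

lemma matrix_holo_uminus: "matrix_holo_on X S A \<Longrightarrow> matrix_holo_on X S (\<lambda>x. - A x)"
  by (auto simp: matrix_holo_on_def intro!: holo_intros)

lemma matrix_holo_transpose: "matrix_holo_on X S A \<Longrightarrow> matrix_holo_on X S (\<lambda>x. transpose (A x))"
  by (auto simp: matrix_holo_on_def transpose_def)

lemma matrix_holo_kron:
  "matrix_holo_on X S A \<Longrightarrow> matrix_holo_on X S B \<Longrightarrow> matrix_holo_on X S (\<lambda>x. kron (A x) (B x))"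
  by (auto simp: matrix_holo_on_def kron_def intro!: holo_intros)

lemma matrix_holo_sym2: "matrix_holo_on X S A \<Longrightarrow> matrix_holo_on X S (\<lambda>x. sym2_matrix (A x))"
  unfolding sym2_matrix_def by (intro matrix_holo_mult matrix_holo_kron matrix_holo_const)

lemmas matrix_holo_intros = matrix_holo_const matrix_holo_mult matrix_holo_add matrix_holo_uminus
  matrix_holo_transpose matrix_holo_kron matrix_holo_sym2

lemma matrix_holo_alt_sym:
  assumes "riemann_surface X" "holo_on X S u" "\<And>x. x \<in> S \<Longrightarrow> u x \<noteq> 0"
  shows "matrix_holo_on X S (\<lambda>x. alt_sym (u x))"
  unfolding matrix_holo_on_def
proof (intro allI)
  fix p q
  have 1: "holo_on X S (\<lambda>x. 1 / u x)"
    using assms by (intro holo_on_divide holo_on_const)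
  show "holo_on X S (\<lambda>x. alt_sym (u x) $ p $ q)"
    by (cases q; cases "p = (1,2)"; cases "p = (2,1)")
       (use 1 in \<open>auto simp: alt_sym_def hcat_def alt_incl_def intro!: holo_on_const holo_on_minus\<close>)
qed

lemma matrix_holo_beta_row:
  assumes "holo_on X S u" "matrix_holo_on X S A"
  shows "matrix_holo_on X S (\<lambda>x. beta_row (u x) (A x))"
proof -
  have "holo_on X S (\<lambda>x. beta_row (u x) (A x) $ i $ j)" for i j
  proof -
    have i: "i = 1" using forall_1[of "\<lambda>i. i = 1"] by simp
    show ?thesis
      unfolding i using exhaust_3[of j] assms(1) matrix_holo_entry[OF assms(2)]
      by (auto simp: beta_row_def vector_3 vector_1 intro!: holo_intros)
  qed
  then show ?thesis unfolding matrix_holo_on_def by blast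
qed

section \<open>The tensor square as an orthogonal Higgs bundle\<close>

lemma trivial_line_bundle: "holomorphic_bundle X trivial_line"
proof -
  have "matrix_inv (mat 1 :: complex^1^1) = mat 1" "invertible (mat 1 :: complex^1^1)"
    using matrix_inv_unique[of "mat 1 :: complex^1^1" "mat 1"] by simp_all
  then show ?thesis
    unfolding holomorphic_bundle_def trivial_line_def
    by (auto intro!: matrix_holo_const)
qed

lemma sl2_bundle_facts:
  assumes V: "sl2_bundle X V"
  shows "transpose (omega V x) = - omega V x" "invertible (omega V x)" "omega V x $ 1 $ 2 \<noteq> 0"
    "det (omega V x) = (omega V x $ 1 $ 2)\<^sup>2" "holomorphic_bundle X (vframes V)"
    "(S, F) \<in> vframes V \<Longrightarrow> open S"
    "(S, F) \<in> vframes V \<Longrightarrow> x \<in> S \<Longrightarrow> invertible (F x)"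
    "(S, F) \<in> vframes V \<Longrightarrow> (S', F') \<in> vframes V \<Longrightarrow> matrix_holo_on X (S \<inter> S') (\<lambda>x. matrix_inv (F x) ** F' x)"
    "(S, F) \<in> vframes V \<Longrightarrow> matrix_holo_on X S (\<lambda>x. transpose (F x) ** omega V x ** F x)"
    "(S, F) \<in> vframes V \<Longrightarrow> holo_on X S (\<lambda>x. omega V x $ 1 $ 2 * det (F x))"
proof -
  note d = V[unfolded sl2_bundle_def holomorphic_form_def holomorphic_bundle_def]
  show sk: "transpose (omega V x) = - omega V x" for x using d by blast
  show inv: "invertible (omega V x)" using d by blast
  show dt: "det (omega V x) = (omega V x $ 1 $ 2)\<^sup>2"
    using skew_entries[OF sk] by (simp add: det_2 power2_eq_square)
  show "omega V x $ 1 $ 2 \<noteq> 0" using dt inv by (auto simp: invertible_det_nz)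
  show "holomorphic_bundle X (vframes V)" using V unfolding sl2_bundle_def by blast
  show "(S, F) \<in> vframes V \<Longrightarrow> open S" using d by blast
  show "(S, F) \<in> vframes V \<Longrightarrow> x \<in> S \<Longrightarrow> invertible (F x)" using d by blast
  show "(S, F) \<in> vframes V \<Longrightarrow> (S', F') \<in> vframes V \<Longrightarrow> matrix_holo_on X (S \<inter> S') (\<lambda>x. matrix_inv (F x) ** F' x)"
    using d by blast
  show h: "(S, F) \<in> vframes V \<Longrightarrow> matrix_holo_on X S (\<lambda>x. transpose (F x) ** omega V x ** F x)"
    using d by blast
  show "(S, F) \<in> vframes V \<Longrightarrow> holo_on X S (\<lambda>x. omega V x $ 1 $ 2 * det (F x))"
    using matrix_holo_entry[OF h, of 1 2] by (simp add: congruence_skew[OF sk])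
qed

lemma alt2_orth_bundle:
  assumes RS: "riemann_surface X" and V: "sl2_bundle X V"
  shows "orth_bundle X (alt2 V)" "form (alt2 V) x = mat 2"
proof -
  note f = sl2_bundle_facts[OF V]
  show q: "form (alt2 V) x = mat 2" for x
    by (simp add: alt2_def alt_incl_gram f)
  have i: "invertible (mat 2 :: complex^1^1)" by (simp add: invertible_det_nz det_1 mat_def)
  have dm: "det (mat 2 :: complex^1^1) = 2" by (simp add: det_1 mat_def)
  have "transpose (mat 2 :: complex^1^1) = mat 2" by (simp add: transpose_mat)
  moreover have "(complex_of_real (sqrt 2))\<^sup>2 = 2"
    by (simp flip: of_real_power)
  ultimately show "orth_bundle X (alt2 V)"
    unfolding orth_bundle_def q holomorphic_form_def
    using trivial_line_bundle[of X] i dm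
    by (auto simp: alt2_def trivial_line_def intro!: matrix_holo_const holo_on_const)
qed

lemma sym2_orth_bundle:
  assumes RS: "riemann_surface X" and V: "sl2_bundle X V"
  shows "orth_bundle X (sym2 V)" "form (sym2 V) x = sym_form (omega V x $ 1 $ 2)"
proof -
  note f = sl2_bundle_facts[OF V]
  have sym2_frames: "frames (sym2 V) = {(S, \<lambda>x. sym2_matrix (F x)) | S F. (S, F) \<in> vframes V}"
    by (simp add: sym2_def)
  show q: "form (sym2 V) x = sym_form (omega V x $ 1 $ 2)" for x
    by (simp add: sym2_def sym_incl_gram f)
  have hb: "holomorphic_bundle X (frames (sym2 V))"
    unfolding holomorphic_bundle_def
  proof (intro conjI)
    show "(\<Union>(S, F)\<in>frames (sym2 V). S) = UNIV"
      using f(5) unfolding holomorphic_bundle_def sym2_frames by blast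
    show "\<forall>(S, F)\<in>frames (sym2 V). open S \<and> (\<forall>x\<in>S. invertible (F x))"
      using f(6,7) sym2_matrix_inv(2) unfolding sym2_frames by blast
    have "matrix_holo_on X (S \<inter> S') (\<lambda>x. matrix_inv (sym2_matrix (F x)) ** sym2_matrix (F' x))"
      if SF: "(S, F) \<in> vframes V" "(S', F') \<in> vframes V" for S F S' F'
    proof (subst matrix_holo_cong[OF RS])
      show "matrix_holo_on X (S \<inter> S') (\<lambda>x. sym2_matrix (matrix_inv (F x) ** F' x))"
        by (intro matrix_holo_intros f(8) that)
      fix x assume "x \<in> S \<inter> S'"
      then show "matrix_inv (sym2_matrix (F x)) ** sym2_matrix (F' x) = sym2_matrix (matrix_inv (F x) ** F' x)"
        using f(7)[OF SF(1)] by (simp add: sym2_matrix_inv sym2_matrix_mult)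
    qed
    then show "\<forall>(S, F)\<in>frames (sym2 V). \<forall>(S', F')\<in>frames (sym2 V).
       matrix_holo_on X (S \<inter> S') (\<lambda>x. matrix_inv (F x) ** F' x)"
      unfolding sym2_frames by blast
  qed
  have form_eq: "transpose (sym2_matrix A) ** form (sym2 V) x ** sym2_matrix A
     = transpose sym_incl ** kron B B ** sym_incl"
    if "B = transpose A ** omega V x ** A" for A B x
  proof -
    have "transpose (sym2_matrix A) ** form (sym2 V) x ** sym2_matrix A
      = transpose (sym_incl ** sym2_matrix A) ** kron (omega V x) (omega V x) ** (sym_incl ** sym2_matrix A)"
      by (simp add: sym2_def matrix_transpose_mul matrix_mul_assoc)
    also have "\<dots> = transpose sym_incl ** (transpose (kron A A) ** kron (omega V x) (omega V x) ** kron A A) ** sym_incl"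
      unfolding kron_sym_incl[symmetric] by (simp add: matrix_transpose_mul matrix_mul_assoc)
    also have "\<dots> = transpose sym_incl ** kron B B ** sym_incl"
      by (simp add: transpose_kron kron_mult that)
    finally show ?thesis .
  qed
  have hf: "holomorphic_form X (frames (sym2 V)) (form (sym2 V))"
  proof -
    have "matrix_holo_on X S (\<lambda>x. transpose (sym2_matrix (F x)) ** form (sym2 V) x ** sym2_matrix (F x))"
      if SF: "(S, F) \<in> vframes V" for S F
      unfolding form_eq[OF refl] by (intro matrix_holo_intros f(9) that)
    then show ?thesis unfolding holomorphic_form_def sym2_frames by blast
  qed
  have s2: "(complex_of_real (sqrt 2))\<^sup>2 = 2"
    by (simp flip: of_real_power)
  have vh: "holo_on X S (\<lambda>x. vol (sym2 V) x * det (sym2_matrix (F x)))"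
    if SF: "(S, F) \<in> vframes V" for S F
  proof -
    have "(\<lambda>x. vol (sym2 V) x * det (sym2_matrix (F x)))
       = (\<lambda>x. - complex_of_real (sqrt 2) * (omega V x $ 1 $ 2 * det (F x)) ^ 3)"
      by (auto simp: sym2_def det_sym2_matrix power_mult_distrib)
    then show ?thesis using f(10)[OF SF] by (auto intro!: holo_intros)
  qed
  have "(vol (sym2 V) x)\<^sup>2 = det (form (sym2 V) x)" for x
    unfolding q det_sym_form using s2 by (simp add: sym2_def power_mult_distrib flip: power_mult)
  moreover have "\<forall>(S, F)\<in>frames (sym2 V). holo_on X S (\<lambda>x. vol (sym2 V) x * det (F x))"
    using vh unfolding sym2_frames by blast
  ultimately show "orth_bundle X (sym2 V)"
    unfolding orth_bundle_def using hb hf f(3)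
    by (simp add: q transpose_sym_form sym_form_inv(2))
qed

lemma matrix_mult_add_rdistrib:
  fixes A B :: "complex^'n^'m" shows "(A + B) ** C = A ** C + B ** C"
  by (simp add: matrix_matrix_mult_def vec_eq_iff sum.distrib algebra_simps)

lemma tensor_bundleE:
  assumes "(R, f) \<in> tensor_bundle E E'"
  obtains S F S' F' where "R = S \<inter> S'" "f = (\<lambda>x. kron (F x) (F' x))" "(S, F) \<in> E" "(S', F') \<in> E'"
proof -
  from assms obtain S F S' F' where "(R, f) = (S \<inter> S', \<lambda>x. kron (F x) (F' x))" "(S, F) \<in> E" "(S', F') \<in> E'"
    unfolding tensor_bundle_def mem_Collect_eq by (elim exE conjE)
  then show ?thesis using that by (simp only: prod.inject)
qed

lemma tensor_bundleI:
  assumes "(S, F) \<in> E" "(S', F') \<in> E'"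
  shows "(S \<inter> S', \<lambda>x. kron (F x) (F' x)) \<in> tensor_bundle E E'"
  unfolding tensor_bundle_def using assms
  by (intro CollectI exI[of _ S] exI[of _ F] exI[of _ S'] exI[of _ F'] conjI refl)

lemma bundle_cover:
  assumes "holomorphic_bundle X E"
  obtains S F where "(S, F) \<in> E" "x \<in> S"
proof -
  have "x \<in> (\<Union>(S, F)\<in>E. S)" using assms unfolding holomorphic_bundle_def by simp
  then show ?thesis using that by auto
qed

text \<open>The transition matrices of the tensor product are the Kronecker products of those of the factors.\<close>

lemma tensor_bundle_holomorphic:
  assumes RS: "riemann_surface X" and E: "holomorphic_bundle X E" and E': "holomorphic_bundle X E'"
  shows "holomorphic_bundle X (tensor_bundle E E')"
proof -
  have op: "open S" "x \<in> S \<Longrightarrow> invertible (F x)" if "(S, F) \<in> E" for S F x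
    using that E unfolding holomorphic_bundle_def by blast+
  have op': "open S" "x \<in> S \<Longrightarrow> invertible (F x)" if "(S, F) \<in> E'" for S F x
    using that E' unfolding holomorphic_bundle_def by blast+
  have tr: "matrix_holo_on X (S \<inter> S') (\<lambda>x. matrix_inv (F x) ** F' x)"
    if "(S, F) \<in> E" "(S', F') \<in> E" for S F S' F'
    using E that unfolding holomorphic_bundle_def by blast
  have tr': "matrix_holo_on X (S \<inter> S') (\<lambda>x. matrix_inv (F x) ** F' x)"
    if "(S, F) \<in> E'" "(S', F') \<in> E'" for S F S' F'
    using E' that unfolding holomorphic_bundle_def by blast
  have cover: "\<exists>p\<in>tensor_bundle E E'. x \<in> fst p" for x
  proof -
    obtain S F where 1: "(S, F) \<in> E" "x \<in> S" using bundle_cover[OF E] .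
    obtain S' F' where 2: "(S', F') \<in> E'" "x \<in> S'" using bundle_cover[OF E'] .
    show ?thesis using tensor_bundleI[OF 1(1) 2(1)] 1(2) 2(2) by (intro bexI) simp_all
  qed
  have trans: "matrix_holo_on X (R \<inter> R') (\<lambda>x. matrix_inv (f x) ** f' x)"
    if Rf: "(R, f) \<in> tensor_bundle E E'" and Rf': "(R', f') \<in> tensor_bundle E E'" for R f R' f'
  proof -
    obtain S F S' F' where 1: "R = S \<inter> S'" "f = (\<lambda>x. kron (F x) (F' x))" "(S, F) \<in> E" "(S', F') \<in> E'"
      using Rf by (rule tensor_bundleE)
    obtain T G T' G' where 2: "R' = T \<inter> T'" "f' = (\<lambda>x. kron (G x) (G' x))" "(T, G) \<in> E" "(T', G') \<in> E'"
      using Rf' by (rule tensor_bundleE)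
    show ?thesis
    proof (subst matrix_holo_cong[OF RS])
      show "matrix_holo_on X (R \<inter> R') (\<lambda>x. kron (matrix_inv (F x) ** G x) (matrix_inv (F' x) ** G' x))"
        unfolding 1(1) 2(1)
        by (intro matrix_holo_kron matrix_holo_subset[OF tr[OF 1(3) 2(3)]]
            matrix_holo_subset[OF tr'[OF 1(4) 2(4)]]) auto
      fix x assume "x \<in> R \<inter> R'"
      then have "invertible (F x)" "invertible (F' x)"
        using op(2)[OF 1(3)] op'(2)[OF 1(4)] 1(1) by auto
      then show "matrix_inv (f x) ** f' x = kron (matrix_inv (F x) ** G x) (matrix_inv (F' x) ** G' x)"
        by (simp add: 1(2) 2(2) kron_inv kron_mult)
    qed
  qed
  have inv: "open R \<and> (\<forall>x\<in>R. invertible (f x))" if Rf: "(R, f) \<in> tensor_bundle E E'" for R f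
  proof -
    obtain S F S' F' where 1: "R = S \<inter> S'" "f = (\<lambda>x. kron (F x) (F' x))" "(S, F) \<in> E" "(S', F') \<in> E'"
      using Rf by (rule tensor_bundleE)
    then show ?thesis using op[OF 1(3)] op'[OF 1(4)] by (auto intro: kron_inv(2))
  qed
  have "(\<Union>(S, F)\<in>tensor_bundle E E'. S) = UNIV"
  proof (rule UNIV_eq_I[symmetric])
    fix x
    obtain p where "p \<in> tensor_bundle E E'" "x \<in> fst p" using cover by blast
    then show "x \<in> (\<Union>(S, F)\<in>tensor_bundle E E'. S)" by (cases p) auto
  qed
  then show ?thesis
    unfolding holomorphic_bundle_def by (intro conjI ballI case_prodI2) (simp_all add: inv trans)
qed

lemma I2_fields:
  "frames (I2 V (neg_higgs V)) = tensor_bundle (vframes V) (vframes V)"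
  "form (I2 V (neg_higgs V)) x = kron (omega V x) (omega V x)"
  "vol (I2 V (neg_higgs V)) x = (det (omega V x))\<^sup>2"
  "higgs (I2 V (neg_higgs V)) c x = tensor_higgs (phi V c x)"
  by (simp_all add: I2_def neg_higgs_def tensor_higgs_def power2_eq_square)

lemma I2_orth_bundle:
  assumes RS: "riemann_surface X" and V: "sl2_bundle X V"
  shows "orth_bundle X (I2 V (neg_higgs V))"
proof -
  note f = sl2_bundle_facts[OF V]
  note k = I2_fields[of V]
  have form: "matrix_holo_on X (S \<inter> S') (\<lambda>x. transpose (kron (F x) (F' x))
       ** kron (omega V x) (omega V x) ** kron (F x) (F' x))"
    if SF: "(S, F) \<in> vframes V" "(S', F') \<in> vframes V" for S F S' F'
    unfolding transpose_kron kron_mult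
    by (intro matrix_holo_kron matrix_holo_subset[OF f(9)[OF SF(1)]] matrix_holo_subset[OF f(9)[OF SF(2)]]) auto
  have vol: "holo_on X (S \<inter> S') (\<lambda>x. (det (omega V x))\<^sup>2 * det (kron (F x) (F' x)))"
    if SF: "(S, F) \<in> vframes V" "(S', F') \<in> vframes V" for S F S' F'
  proof -
    have "(\<lambda>x. (det (omega V x))\<^sup>2 * det (kron (F x) (F' x)))
      = (\<lambda>x. (omega V x $ 1 $ 2 * det (F x))\<^sup>2 * (omega V x $ 1 $ 2 * det (F' x))\<^sup>2)"
      by (auto simp: det_kron f(4) power2_eq_square)
    then show ?thesis
      using holo_on_subset[OF f(10)[OF SF(1)], of "S \<inter> S'"] holo_on_subset[OF f(10)[OF SF(2)], of "S \<inter> S'"]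
      by (auto intro!: holo_intros)
  qed
  have tk: "transpose (kron (omega V x) (omega V x)) = kron (omega V x) (omega V x)" for x
    unfolding transpose_kron f(1) by (simp add: kron_def vec_eq_iff)
  show ?thesis
    unfolding orth_bundle_def holomorphic_form_def
  proof (intro conjI allI)
    show "holomorphic_bundle X (frames (I2 V (neg_higgs V)))"
      unfolding k by (rule tensor_bundle_holomorphic[OF RS f(5) f(5)])
    show "\<forall>(S, F)\<in>frames (I2 V (neg_higgs V)).
       matrix_holo_on X S (\<lambda>x. transpose (F x) ** form (I2 V (neg_higgs V)) x ** F x)"
      unfolding k using form by (auto elim!: tensor_bundleE)
    show "\<forall>(S, F)\<in>frames (I2 V (neg_higgs V)). holo_on X S (\<lambda>x. vol (I2 V (neg_higgs V)) x * det (F x))"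
      unfolding k using vol by (auto elim!: tensor_bundleE)
    show "transpose (form (I2 V (neg_higgs V)) x) = form (I2 V (neg_higgs V)) x" for x
      unfolding k by (rule tk)
    show "invertible (form (I2 V (neg_higgs V)) x)" for x
      unfolding k by (intro kron_inv(2) f(2))
    show "(vol (I2 V (neg_higgs V)) x)\<^sup>2 = det (form (I2 V (neg_higgs V)) x)" for x
      unfolding k det_kron by (simp only: power2_eq_square)
  qed
qed

lemma I2_so_higgs:
  assumes RS: "riemann_surface X" and V: "sl2_higgs X V"
  shows "so_higgs X (I2 V (neg_higgs V))"
proof -
  have Vb: "sl2_bundle X V" using V unfolding sl2_higgs_def by blast
  note f = sl2_bundle_facts[OF Vb]
  note k = I2_fields[of V]
  have cv: "canonical_valued X (phi V)"
    and hol: "\<And>S F c. (S, F) \<in> vframes V \<Longrightarrow> c \<in> X \<Longrightarrow>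
      matrix_holo_on X (S \<inter> fst c) (\<lambda>x. matrix_inv (F x) ** phi V c x ** F x)"
    and tr: "\<And>c x. c \<in> X \<Longrightarrow> x \<in> fst c \<Longrightarrow> trace (phi V c x) = 0"
    using V unfolding sl2_higgs_def holomorphic_endo_K_def by blast+
  have cvI: "canonical_valued X (higgs (I2 V (neg_higgs V)))"
    unfolding canonical_valued_def
  proof (intro ballI allI)
    fix c c' x i j assume a: "c \<in> X" "c' \<in> X" "x \<in> fst c \<inter> fst c'"
    have "phi V c x $ i $ j = deriv (snd c' \<circ> chart_inv c) (snd c x) * phi V c' x $ i $ j" for i j
      using cv a unfolding canonical_valued_def by blast
    then show "higgs (I2 V (neg_higgs V)) c x $ i $ j
       = deriv (snd c' \<circ> chart_inv c) (snd c x) * higgs (I2 V (neg_higgs V)) c' x $ i $ j"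
      unfolding k tensor_higgs_def kron_def by (simp add: algebra_simps)
  qed
  have hh: "matrix_holo_on X ((S \<inter> S') \<inter> fst c)
      (\<lambda>x. matrix_inv (kron (F x) (F' x)) ** tensor_higgs (phi V c x) ** kron (F x) (F' x))"
    if SF: "(S, F) \<in> vframes V" "(S', F') \<in> vframes V" and c: "c \<in> X" for S F S' F' c
  proof (subst matrix_holo_cong[OF RS])
    show "matrix_holo_on X ((S \<inter> S') \<inter> fst c) (\<lambda>x. kron (matrix_inv (F x) ** phi V c x ** F x) (mat 1)
        + kron (mat 1) (- (matrix_inv (F' x) ** phi V c x ** F' x)))"
      by (intro matrix_holo_add matrix_holo_kron matrix_holo_const matrix_holo_uminus
          matrix_holo_subset[OF hol[OF SF(1) c]] matrix_holo_subset[OF hol[OF SF(2) c]]) auto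
    fix x assume "x \<in> (S \<inter> S') \<inter> fst c"
    then have i: "invertible (F x)" "invertible (F' x)" using f(7) SF by blast+
    have "matrix_inv (F' x) ** (- phi V c x) ** F' x = - (matrix_inv (F' x) ** phi V c x ** F' x)"
      by (simp add: matrix_matrix_mult_def vec_eq_iff sum_negf)
    then show "matrix_inv (kron (F x) (F' x)) ** tensor_higgs (phi V c x) ** kron (F x) (F' x)
      = kron (matrix_inv (F x) ** phi V c x ** F x) (mat 1)
        + kron (mat 1) (- (matrix_inv (F' x) ** phi V c x ** F' x))"
      using i unfolding tensor_higgs_def
      by (simp add: kron_inv matrix_add_ldistrib matrix_mult_add_rdistrib kron_mult matrix_inv_mult)
  qed
  have skew: "transpose (tensor_higgs (phi V c x)) ** kron (omega V x) (omega V x)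
       + kron (omega V x) (omega V x) ** tensor_higgs (phi V c x) = 0"
    if c: "c \<in> X" "x \<in> fst c" for c x
  proof -
    define A M where "A = phi V c x" and "M = omega V x"
    have s: "transpose A ** M + M ** A = 0"
      unfolding A_def M_def by (rule tracefree_skew[OF f(1) tr[OF c]])
    have "transpose (- A) ** M + M ** (- A) = - (transpose A ** M + M ** A)"
      by (simp add: matrix_matrix_mult_def transpose_def vec_eq_iff sum_negf)
    then have s': "transpose (- A) ** M + M ** (- A) = 0" using s by simp
    have "transpose (tensor_higgs A) ** kron M M + kron M M ** tensor_higgs A
      = kron (transpose A ** M + M ** A) M + kron M (transpose (- A) ** M + M ** (- A))"
    proof -
      have "transpose (tensor_higgs A) = kron (transpose A) (mat 1) + kron (mat 1) (transpose (- A))"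
        unfolding tensor_higgs_def transpose_kron[symmetric, of "mat 1", simplified]
        by (simp add: transpose_def kron_def mat_def vec_eq_iff)
      then show ?thesis
        by (simp add: tensor_higgs_def matrix_add_ldistrib matrix_mult_add_rdistrib kron_mult kron_add_left kron_add_right)
    qed
    then show ?thesis unfolding s s' kron_0 unfolding A_def M_def by simp
  qed
  show ?thesis
    unfolding so_higgs_def holomorphic_endo_K_def
  proof (intro conjI I2_orth_bundle RS Vb cvI)
    show "\<forall>(S, F)\<in>frames (I2 V (neg_higgs V)). \<forall>c\<in>X. matrix_holo_on X (S \<inter> fst c)
       (\<lambda>x. matrix_inv (F x) ** higgs (I2 V (neg_higgs V)) c x ** F x)"
      unfolding k using hh by (auto elim!: tensor_bundleE)
    show "\<forall>c\<in>X. \<forall>x\<in>fst c. transpose (higgs (I2 V (neg_higgs V)) c x) ** form (I2 V (neg_higgs V)) x +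
         form (I2 V (neg_higgs V)) x ** higgs (I2 V (neg_higgs V)) c x = 0"
      unfolding k using skew by blast
  qed
qed

definition sym_beta :: "'a sl2_higgs \<Rightarrow> 'a chart \<Rightarrow> 'a \<Rightarrow> complex^3^1" where
  "sym_beta V c x = beta_row (omega V x $ 1 $ 2) (phi V c x)"

definition sym_so13 :: "'a sl2_higgs \<Rightarrow> 'a so13_higgs" where
  "sym_so13 V = \<lparr>O13 = alt2 V, W13 = sym2 V, beta = sym_beta V\<rparr>"

text \<open>The frame F carries \<open>\<phi>\<close> to its matrix in this frame, and the row of that matrix is scaled by the
value of \<open>\<omega>\<close> on F.\<close>

lemma sym_beta_frame:
  assumes "transpose (omega V x) = - omega V x" "invertible (F x)"
  shows "sym_beta V c x ** sym2_matrix (F x)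
     = beta_row ((transpose (F x) ** omega V x ** F x) $ 1 $ 2) (matrix_inv (F x) ** phi V c x ** F x)"
proof -
  have "phi V c x ** F x = F x ** (matrix_inv (F x) ** phi V c x ** F x)"
    using matrix_inv_mult(1)[OF assms(2)] by (simp add: matrix_mul_assoc)
  then show ?thesis
    unfolding sym_beta_def congruence_skew[OF assms(1)] by (rule beta_row_sym2)
qed

lemma so13_higgs_sym:
  assumes RS: "riemann_surface X" and V: "sl2_higgs X V"
  shows "so13_higgs X (sym_so13 V)"
proof -
  have Vb: "sl2_bundle X V" using V unfolding sl2_higgs_def by blast
  note f = sl2_bundle_facts[OF Vb]
  have cv: "canonical_valued X (phi V)"
    and hol: "\<And>S F c. (S, F) \<in> vframes V \<Longrightarrow> c \<in> X \<Longrightarrow>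
      matrix_holo_on X (S \<inter> fst c) (\<lambda>x. matrix_inv (F x) ** phi V c x ** F x)"
    using V unfolding sl2_higgs_def holomorphic_endo_K_def by blast+
  have cvb: "canonical_valued X (sym_beta V)"
    unfolding canonical_valued_def
  proof (intro ballI allI)
    fix c c' x and i :: 1 and j :: 3 assume a: "c \<in> X" "c' \<in> X" "x \<in> fst c \<inter> fst c'"
    have e: "phi V c x $ i $ j = deriv (snd c' \<circ> chart_inv c) (snd c x) * phi V c' x $ i $ j" for i j
      using cv a unfolding canonical_valued_def by blast
    have "\<forall>i j. sym_beta V c x $ i $ j
       = deriv (snd c' \<circ> chart_inv c) (snd c x) * sym_beta V c' x $ i $ j"
      unfolding sym_beta_def beta_row_def forall_1 forall_3 e by (simp add: vector_3 vector_1 algebra_simps)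
    then show "sym_beta V c x $ i $ j
       = deriv (snd c' \<circ> chart_inv c) (snd c x) * sym_beta V c' x $ i $ j" by blast
  qed
  have hb: "matrix_holo_on X (S \<inter> fst c) (\<lambda>x. sym_beta V c x ** sym2_matrix (F x))"
    if SF: "(S, F) \<in> vframes V" and c: "c \<in> X" for S F c
  proof (subst matrix_holo_cong[OF RS])
    show "matrix_holo_on X (S \<inter> fst c) (\<lambda>x. beta_row ((transpose (F x) ** omega V x ** F x) $ 1 $ 2)
        (matrix_inv (F x) ** phi V c x ** F x))"
      by (intro matrix_holo_beta_row hol[OF SF c] holo_on_subset[OF matrix_holo_entry[OF f(9)[OF SF]]]) auto
    fix x assume "x \<in> S \<inter> fst c"
    then show "sym_beta V c x ** sym2_matrix (F x)
     = beta_row ((transpose (F x) ** omega V x ** F x) $ 1 $ 2) (matrix_inv (F x) ** phi V c x ** F x)"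
      by (intro sym_beta_frame f(1) f(7)[OF SF]) auto
  qed
  have sf: "frames (sym2 V) = {(S, \<lambda>x. sym2_matrix (F x)) | S F. (S, F) \<in> vframes V}"
    by (simp add: sym2_def)
  have "\<forall>(S, F)\<in>frames (sym2 V). \<forall>c\<in>X. matrix_holo_on X (S \<inter> fst c) (\<lambda>x. sym_beta V c x ** F x)"
    unfolding sf using hb by blast
  moreover have "frames (alt2 V) = trivial_line" by (simp add: alt2_def)
  ultimately show ?thesis
    unfolding so13_higgs_def sym_so13_def
    using alt2_orth_bundle(1)[OF RS Vb] sym2_orth_bundle(1)[OF RS Vb] cvb by simp
qed

lemma so13_to_so4_sym:
  assumes V: "sl2_bundle X V" and RS: "riemann_surface X"
  shows "frames (so13_to_so4 (sym_so13 V)) = {(S, \<lambda>x. block (mat 1) 0 0 (sym2_matrix (F x))) | S F. (S, F) \<in> vframes V}"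
   "form (so13_to_so4 (sym_so13 V)) x = block (mat 2) 0 0 (sym_form (omega V x $ 1 $ 2))"
   "vol (so13_to_so4 (sym_so13 V)) x = - 2 * (omega V x $ 1 $ 2) ^ 3"
   "higgs (so13_to_so4 (sym_so13 V)) c x = block 0 (sym_beta V c x)
      (- orth_transpose (mat 2) (sym_form (omega V x $ 1 $ 2)) (sym_beta V c x)) 0"
proof -
  have s2: "complex_of_real (sqrt 2) * complex_of_real (sqrt 2) = 2"
    by (simp flip: of_real_mult)
  show "frames (so13_to_so4 (sym_so13 V)) = {(S, \<lambda>x. block (mat 1) 0 0 (sym2_matrix (F x))) | S F. (S, F) \<in> vframes V}"
  proof (rule Set.set_eqI)
    have fr: "frames (so13_to_so4 (sym_so13 V)) = sum_bundle trivial_line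
        {(S, \<lambda>x. sym2_matrix (F x)) | S F. (S, F) \<in> vframes V}"
      by (simp add: so13_to_so4_def sym_so13_def alt2_def sym2_def)
    have sb: "sum_bundle trivial_line E = {(S, \<lambda>x. block (mat 1) 0 0 (F x)) | S F. (S, F) \<in> E}" for E
      unfolding sum_bundle_def trivial_line_def by simp
    fix p
    show "p \<in> frames (so13_to_so4 (sym_so13 V)) \<longleftrightarrow>
       p \<in> {(S, \<lambda>x. block (mat 1) 0 0 (sym2_matrix (F x))) | S F. (S, F) \<in> vframes V}"
    proof
      assume "p \<in> frames (so13_to_so4 (sym_so13 V))"
      then show "p \<in> {(S, \<lambda>x. block (mat 1) 0 0 (sym2_matrix (F x))) | S F. (S, F) \<in> vframes V}"
        unfolding fr sb by auto
    next
      assume "p \<in> {(S, \<lambda>x. block (mat 1) 0 0 (sym2_matrix (F x))) | S F. (S, F) \<in> vframes V}"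
      then obtain S F where p: "p = (S, \<lambda>x. block (mat 1) 0 0 (sym2_matrix (F x)))" "(S, F) \<in> vframes V"
        by blast
      then show "p \<in> frames (so13_to_so4 (sym_so13 V))"
        unfolding fr sb p(1)
        by (intro CollectI exI[of _ S] exI[of _ "\<lambda>x. sym2_matrix (F x)"] exI[of _ F] conjI refl)
    qed
  qed
  show "form (so13_to_so4 (sym_so13 V)) x = block (mat 2) 0 0 (sym_form (omega V x $ 1 $ 2))"
   "higgs (so13_to_so4 (sym_so13 V)) c x = block 0 (sym_beta V c x)
      (- orth_transpose (mat 2) (sym_form (omega V x $ 1 $ 2)) (sym_beta V c x)) 0"
    by (simp_all add: so13_to_so4_def sym_so13_def alt2_orth_bundle[OF RS V] sym2_orth_bundle[OF RS V])
  show "vol (so13_to_so4 (sym_so13 V)) x = - 2 * (omega V x $ 1 $ 2) ^ 3"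
    using s2 by (simp add: so13_to_so4_def sym_so13_def alt2_def sym2_def)
qed

lemma alt_sym_map_eq: "alt_sym_map V x = alt_sym (omega V x $ 1 $ 2)"
  by (simp add: alt_sym_map_def alt_sym_def hcat_def)

text \<open>On a fibre this is \<open>tensor_higgs_sym\<close> and \<open>tensor_higgs_alt\<close>, the Gram matrices of the summands, and the
orientation computed in \<open>det_alt_sym\<close>. In frames the identification is holomorphic by
\<open>alt_sym_block\<close>.\<close>

lemma so_higgs_iso_sym:
  assumes RS: "riemann_surface X" and V: "sl2_higgs X V"
  shows "so_higgs_iso X index_map (alt_sym_map V) (so13_to_so4 (sym_so13 V)) (I2 V (neg_higgs V))"
proof -
  have Vb: "sl2_bundle X V" using V unfolding sl2_higgs_def by blast
  note f = sl2_bundle_facts[OF Vb]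
  note k = I2_fields[of V]
  note s = so13_to_so4_sym[OF Vb RS]
  have tr: "\<And>c x. c \<in> X \<Longrightarrow> x \<in> fst c \<Longrightarrow> trace (phi V c x) = 0"
    using V unfolding sl2_higgs_def by blast
  have hol: "matrix_holo_on X (S \<inter> (T \<inter> T')) (\<lambda>x. matrix_inv (kron (G x) (G' x)) ** alt_sym (omega V x $ 1 $ 2)
       ** block (mat 1) 0 0 (sym2_matrix (F x)))"
    if SF: "(S, F) \<in> vframes V" "(T, G) \<in> vframes V" "(T', G') \<in> vframes V" for S F T G T' G'
  proof (subst matrix_holo_cong[OF RS])
    show "matrix_holo_on X (S \<inter> (T \<inter> T')) (\<lambda>x. kron (matrix_inv (G x) ** F x) (matrix_inv (G' x) ** F x)
        ** alt_sym (omega V x $ 1 $ 2 * det (F x)))"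
    proof (rule matrix_holo_mult[OF matrix_holo_kron[OF matrix_holo_subset[OF f(8)[OF SF(2,1)]]
          matrix_holo_subset[OF f(8)[OF SF(3,1)]]]
          matrix_holo_alt_sym[OF RS holo_on_subset[OF f(10)[OF SF(1)]]]])
      show "omega V x $ 1 $ 2 * det (F x) \<noteq> 0" if "x \<in> S \<inter> (T \<inter> T')" for x
        using that f(3) f(7)[OF SF(1)] by (auto simp: invertible_det_nz)
    qed auto
    fix x assume x: "x \<in> S \<inter> (T \<inter> T')"
    have i: "invertible (G x)" "invertible (G' x)" "det (F x) \<noteq> 0"
      using x f(7) SF by (auto simp flip: invertible_det_nz)
    show "matrix_inv (kron (G x) (G' x)) ** alt_sym (omega V x $ 1 $ 2) ** block (mat 1) 0 0 (sym2_matrix (F x))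
      = kron (matrix_inv (G x) ** F x) (matrix_inv (G' x) ** F x) ** alt_sym (omega V x $ 1 $ 2 * det (F x))"
      unfolding matrix_mul_assoc[symmetric] alt_sym_block[OF i(3)] kron_inv[OF i(1,2)]
      unfolding matrix_mul_assoc kron_mult ..
  qed
  have bi: "bundle_iso X (alt_sym_map V) (frames (so13_to_so4 (sym_so13 V))) (frames (I2 V (neg_higgs V)))"
    unfolding bundle_iso_def alt_sym_map_eq s k
    using hol f(3) invertible_alt_sym by (auto elim!: tensor_bundleE)
  have gram: "transpose (alt_sym (omega V x $ 1 $ 2)) ** kron (omega V x) (omega V x) ** alt_sym (omega V x $ 1 $ 2)
      = block (mat 2) 0 0 (sym_form (omega V x $ 1 $ 2))" for x
    unfolding alt_sym_def hcat_gram by (simp add: alt_incl_gram sym_incl_gram alt_sym_orthogonal f)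
  have vol: "- 2 * (omega V x $ 1 $ 2) ^ 3 = (det (omega V x))\<^sup>2 * det (\<chi> i j. alt_sym (omega V x $ 1 $ 2) $ index_map i $ j)" for x
    unfolding det_alt_sym[OF f(3)] f(4) using f(3)[of x] by (simp add: field_simps flip: power_mult) (simp add: eval_nat_numeral)
  have higgs: "alt_sym (omega V x $ 1 $ 2) ** block 0 (sym_beta V c x)
      (- orth_transpose (mat 2) (sym_form (omega V x $ 1 $ 2)) (sym_beta V c x)) 0
     = tensor_higgs (phi V c x) ** alt_sym (omega V x $ 1 $ 2)" if "c \<in> X" "x \<in> fst c" for c x
    unfolding alt_sym_def hcat_mult_block mult_hcat sym_beta_def
    by (simp add: tensor_higgs_sym[OF f(3)[of x]] tensor_higgs_alt[OF f(3) tr[OF that]])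
  show ?thesis
    unfolding so_higgs_iso_def orth_iso_def
    using bi bij_index_map gram vol higgs by (simp only: alt_sym_map_eq s k) blast
qed

lemma sym_beta_symplectic:
  assumes V: "sl2_higgs X V" and F: "local_frame X (vframes V) S F"
    and sp: "transpose (F x) ** omega V x ** F x = vector [vector [0, 1], vector [-1, 0]]"
    and x: "x \<in> S" and phi: "matrix_inv (F x) ** phi V k x ** F x = vector [vector [a, b], vector [c, -a]]"
  shows "sym_beta V k x ** sym2_matrix (F x) = vector [vector [-c, 2 * a, b]]"
proof -
  have Vb: "sl2_bundle X V" using V unfolding sl2_higgs_def by blast
  have "invertible (F x)" using F x unfolding local_frame_def by blast
  then have "sym_beta V k x ** sym2_matrix (F x)
     = beta_row ((transpose (F x) ** omega V x ** F x) $ 1 $ 2) (matrix_inv (F x) ** phi V k x ** F x)"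
    by (intro sym_beta_frame sl2_bundle_facts(1)[OF Vb])
  then show ?thesis unfolding sp phi beta_row_def by simp
qed

section \<open>The double cover of SO(3,C) by SL(2,C)\<close>

definition SL2 :: "(complex^2^2) set" where
  "SL2 = {A. det A = 1}"

text \<open>The columns are orthonormal for \<open>sym_form 1\<close>, the form on \<open>Sym\<^sup>2V\<close> in a symplectic frame. Since this
form has determinant 2, a factor \<open>\<surd>2\<close> has to occur.\<close>

definition sym_onb :: "complex^3^3" where
  "sym_onb = vector [vector [1, \<i>, 0], vector [0, 0, \<i> / complex_of_real (sqrt 2)], vector [1/2, - \<i>/2, 0]]"

definition sym_onb_inv :: "complex^3^3" where
  "sym_onb_inv = transpose sym_onb ** sym_form 1"

text \<open>The representation of SL(2,C) on the symmetric square, written in an orthonormal basis.\<close>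

definition spin :: "complex^2^2 \<Rightarrow> complex^3^3" where
  "spin A = sym_onb_inv ** sym2_matrix A ** sym_onb"

lemma sqrt_2_squared: "complex_of_real (sqrt 2) * complex_of_real (sqrt 2) = 2"
  by (simp flip: of_real_mult)

lemma sym_onb_inverse: "sym_onb_inv ** sym_onb = mat 1" "sym_onb ** sym_onb_inv = mat 1"
proof -
  have "\<i> * \<i> / (complex_of_real (sqrt 2) * complex_of_real (sqrt 2)) = - (1/2)"
    unfolding sqrt_2_squared by simp
  then show 1: "sym_onb_inv ** sym_onb = mat 1"
    unfolding sym_onb_inv_def sym_onb_def sym_form_def
    by (simp add: mat_entries vector_3)
  show "sym_onb ** sym_onb_inv = mat 1" using 1 matrix_left_right_inverse by blast
qed

lemma spin_mult: "spin (A ** B) = spin A ** spin B"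
proof -
  have "spin A ** spin B = sym_onb_inv ** sym2_matrix A ** (sym_onb ** sym_onb_inv) ** sym2_matrix B ** sym_onb"
    unfolding spin_def by (simp only: matrix_mul_assoc)
  then show ?thesis
    unfolding sym_onb_inverse spin_def sym2_matrix_mult by (simp add: matrix_mul_assoc)
qed

lemma spin_1: "spin (mat 1) = mat 1"
  unfolding spin_def sym2_matrix_1 by (simp add: sym_onb_inverse)

lemma sym2_matrix_uminus: "sym2_matrix (- A) = sym2_matrix A"
  unfolding sym2_matrix_entries by simp

lemma spin_uminus: "spin (- A) = spin A"
  unfolding spin_def sym2_matrix_uminus ..

lemma sym2_spin: "sym2_matrix A = sym_onb ** spin A ** sym_onb_inv"
proof -
  have "sym_onb ** spin A ** sym_onb_inv = (sym_onb ** sym_onb_inv) ** sym2_matrix A ** (sym_onb ** sym_onb_inv)"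
    unfolding spin_def by (simp only: matrix_mul_assoc)
  then show ?thesis unfolding sym_onb_inverse by simp
qed

lemma sym2_matrix_form: "transpose (sym2_matrix A) ** sym_form 1 ** sym2_matrix A = sym_form (det A)"
  unfolding sym2_matrix_entries sym_form_def det_2
  by (simp add: mat_entries vector_3 power2_eq_square algebra_simps)

lemma SL2_mult: "A \<in> SL2 \<Longrightarrow> B \<in> SL2 \<Longrightarrow> A ** B \<in> SL2"
  by (simp add: SL2_def det_mul)

lemma SL2_1: "mat 1 \<in> SL2"
  by (simp add: SL2_def)

lemma SL2_uminus: "A \<in> SL2 \<Longrightarrow> - A \<in> SL2"
  by (simp add: SL2_def det_2)

text \<open>The adjugate, which is the inverse on SL(2,C) and, unlike \<open>matrix_inv\<close>, visibly continuous.\<close>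

definition adj2 :: "complex^2^2 \<Rightarrow> complex^2^2" where
  "adj2 A = vector [vector [A$2$2, - A$1$2], vector [- A$2$1, A$1$1]]"

lemma adj2_mult:
  assumes "A \<in> SL2"
  shows "adj2 A ** A = mat 1" "A ** adj2 A = mat 1"
  using assms unfolding SL2_def adj2_def
  by (simp_all add: mat_entries det_2 algebra_simps)

lemma SL2_adj2: "A \<in> SL2 \<Longrightarrow> adj2 A \<in> SL2"
  by (simp add: SL2_def adj2_def det_2 algebra_simps)

lemma SL2_matrix_inv: "A \<in> SL2 \<Longrightarrow> matrix_inv A = adj2 A \<and> invertible A"
  using matrix_inv_unique[of A "adj2 A"] adj2_mult by blast

lemma sym_onb_det: "det sym_onb_inv * det sym_onb = 1"
  using arg_cong[OF sym_onb_inverse(1), of det] by (simp add: det_mul)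

lemma spin_in_SO:
  assumes "A \<in> SL2" shows "spin A \<in> SO_group"
proof -
  have "det (spin A) = 1"
    using assms sym_onb_det by (simp add: spin_def det_mul det_sym2_matrix SL2_def mult.commute)
  moreover have "transpose (spin A) ** spin A = mat 1"
  proof -
    have t: "transpose sym_onb_inv = sym_form 1 ** sym_onb"
      by (simp add: sym_onb_inv_def matrix_transpose_mul transpose_sym_form)
    have "transpose (spin A) ** spin A = transpose sym_onb ** transpose (sym2_matrix A) ** sym_form 1
        ** (sym_onb ** sym_onb_inv) ** sym2_matrix A ** sym_onb"
      unfolding spin_def by (simp add: matrix_transpose_mul t matrix_mul_assoc)
    also have "\<dots> = transpose sym_onb ** (transpose (sym2_matrix A) ** sym_form 1 ** sym2_matrix A) ** sym_onb"
      unfolding sym_onb_inverse by (simp add: matrix_mul_assoc)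
    also have "\<dots> = sym_onb_inv ** sym_onb"
      using assms by (simp add: sym2_matrix_form SL2_def sym_onb_inv_def)
    finally show ?thesis by (simp add: sym_onb_inverse)
  qed
  ultimately show ?thesis by (simp add: SO_group_def)
qed

lemma SO_group_inverse:
  assumes "A \<in> SO_group"
  shows "transpose A ** A = mat 1" "A ** transpose A = mat 1" "transpose A \<in> SO_group"
proof -
  show 1: "transpose A ** A = mat 1" using assms by (simp add: SO_group_def)
  then show 2: "A ** transpose A = mat 1" using matrix_left_right_inverse by blast
  show "transpose A \<in> SO_group" using assms 2 by (simp add: SO_group_def det_transpose)
qed

text \<open>The isotropic vectors of \<open>Sym\<^sup>2V\<close> are the squares: (x, y, z) is the square of \<open>a e + c f\<close>.\<close>

lemma isotropic_vector_square:
  fixes x y z :: complex assumes "x * z = y\<^sup>2"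
  obtains a c where "a\<^sup>2 = x" "a * c = y" "c\<^sup>2 = z"
proof (cases "x = 0")
  case True
  then have "y = 0" using assms by simp
  then show ?thesis using that[of 0 "csqrt z"] True by simp
next
  case False
  let ?a = "csqrt x"
  have "?a \<noteq> 0" using False by simp
  moreover have "(y / ?a)\<^sup>2 = z" using assms False by (simp add: power_divide field_simps)
  ultimately show ?thesis using that[of ?a "y / ?a"] by simp
qed

text \<open>The first and the last column of S are isotropic, hence the squares of vectors (a, c) and (b, d).
That the two columns pair to 1 means \<open>(ad - bc)\<^sup>2 = 1\<close>, and replacing (b, d) by its negative gives
\<open>ad - bc = 1\<close>. The middle column is orthogonal to the two others, which determines it up to a
scalar, and \<open>det S = 1\<close> determines the scalar.\<close>

lemma sym2_matrix_surj:
  assumes S: "transpose S ** sym_form 1 ** S = sym_form 1" and dS: "det S = 1"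
  obtains A where "A \<in> SL2" "sym2_matrix A = S"
proof -
  have e: "S$3$i * S$1$j - 2 * (S$2$i * S$2$j) + S$1$i * S$3$j = sym_form 1 $ i $ j" for i j
    using arg_cong[OF S, of "\<lambda>M. M$i$j"]
    by (simp add: matrix_matrix_mult_def transpose_def sum_3 sym_form_def vector_3 algebra_simps)
  have e11: "S$1$1 * S$3$1 = (S$2$1)\<^sup>2" and e33: "S$1$3 * S$3$3 = (S$2$3)\<^sup>2"
    using e[of 1 1] e[of 3 3] by (simp_all add: sym_form_def vector_3 power2_eq_square algebra_simps)
  obtain a c where ac: "a\<^sup>2 = S$1$1" "a * c = S$2$1" "c\<^sup>2 = S$3$1"
    using isotropic_vector_square[OF e11] .
  obtain b0 d0 where bd0: "b0\<^sup>2 = S$1$3" "b0 * d0 = S$2$3" "d0\<^sup>2 = S$3$3"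
    using isotropic_vector_square[OF e33] .
  have "(a * d0 - b0 * c)\<^sup>2 = a\<^sup>2 * d0\<^sup>2 - 2 * ((a * c) * (b0 * d0)) + c\<^sup>2 * b0\<^sup>2"
    by (simp add: power2_eq_square algebra_simps)
  also have "\<dots> = 1"
    unfolding ac bd0 using e[of 1 3] by (simp add: sym_form_def vector_3 algebra_simps)
  finally have "a * d0 - b0 * c = 1 \<or> a * d0 - b0 * c = -1"
    by (simp add: power2_eq_1_iff)
  then obtain b d where bd: "b\<^sup>2 = S$1$3" "b * d = S$2$3" "d\<^sup>2 = S$3$3" and det: "a * d - b * c = 1"
  proof
    assume "a * d0 - b0 * c = 1"
    then show ?thesis using that[of b0 d0] bd0 by simp
  next
    assume "a * d0 - b0 * c = -1"
    then have "a * (- d0) - (- b0) * c = 1" by (simp add: algebra_simps)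
    then show ?thesis using that[of "- b0" "- d0"] bd0 by simp
  qed
  (* E1, E2 are orthogonality of the middle column (u, v, w) to the outer columns. In terms of the basis
     consisting of the outer columns and (2ab, ad + bc, 2cd), the coefficients of (u, v, w) are
     these two pairings and det S. *)
  define u v w where uvw: "u = S$1$2" "v = S$2$2" "w = S$3$2"
  have E1: "a\<^sup>2 * w + c\<^sup>2 * u - 2 * (a * c) * v = 0"
    using e[of 1 2] unfolding ac uvw by (simp add: sym_form_def vector_3 algebra_simps)
  have E2: "b\<^sup>2 * w + d\<^sup>2 * u - 2 * (b * d) * v = 0"
    using e[of 3 2] unfolding bd uvw by (simp add: sym_form_def vector_3 algebra_simps)
  have "det S = (a * d - b * c) * (v * (a * d + b * c) - a * b * w - c * d * u)"
    unfolding det_3 ac[symmetric] bd[symmetric] uvw[symmetric]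
    by (simp add: power2_eq_square algebra_simps)
  then have E3: "v * (a * d + b * c) - a * b * w - c * d * u = 1"
    using dS det by simp
  have "(a * d - b * c)\<^sup>2 * u = a\<^sup>2 * (b\<^sup>2 * w + d\<^sup>2 * u - 2 * (b * d) * v)
     + b\<^sup>2 * (a\<^sup>2 * w + c\<^sup>2 * u - 2 * (a * c) * v)
     + 2 * a * b * (v * (a * d + b * c) - a * b * w - c * d * u)"
    by (simp add: power2_eq_square algebra_simps)
  then have u: "u = 2 * a * b" unfolding det E1 E2 E3 by simp
  have "(a * d - b * c)\<^sup>2 * w = c\<^sup>2 * (b\<^sup>2 * w + d\<^sup>2 * u - 2 * (b * d) * v)
     + d\<^sup>2 * (a\<^sup>2 * w + c\<^sup>2 * u - 2 * (a * c) * v)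
     + 2 * c * d * (v * (a * d + b * c) - a * b * w - c * d * u)"
    by (simp add: power2_eq_square algebra_simps)
  then have w: "w = 2 * c * d" unfolding det E1 E2 E3 by simp
  have "(a * d - b * c)\<^sup>2 * v = a * c * (b\<^sup>2 * w + d\<^sup>2 * u - 2 * (b * d) * v)
     + b * d * (a\<^sup>2 * w + c\<^sup>2 * u - 2 * (a * c) * v)
     + (a * d + b * c) * (v * (a * d + b * c) - a * b * w - c * d * u)"
    by (simp add: power2_eq_square algebra_simps)
  then have v: "v = a * d + b * c" unfolding det E1 E2 E3 by simp
  define A :: "complex^2^2" where "A = vector [vector [a, b], vector [c, d]]"
  have "A \<in> SL2" using det by (simp add: A_def SL2_def det_2)
  moreover have "sym2_matrix A = S"
    unfolding sym2_matrix_entries A_def using ac bd u v w uvw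
    by (simp add: vec_eq_iff forall_3 vector_3)
  ultimately show ?thesis using that by blast
qed

lemma spin_surj:
  assumes "R \<in> SO_group"
  obtains A where "A \<in> SL2" "spin A = R"
proof -
  define S where "S = sym_onb ** R ** sym_onb_inv"
  have "det S = 1"
    using assms sym_onb_det by (simp add: S_def det_mul SO_group_def mult.commute)
  moreover have "transpose S ** sym_form 1 ** S = sym_form 1"
  proof -
    have t: "transpose sym_onb_inv = sym_form 1 ** sym_onb"
      by (simp add: sym_onb_inv_def matrix_transpose_mul transpose_sym_form)
    have "transpose S ** sym_form 1 ** S = transpose sym_onb_inv ** transpose R **
       (sym_onb_inv ** sym_onb) ** R ** sym_onb_inv"
      unfolding S_def by (simp add: matrix_transpose_mul matrix_mul_assoc sym_onb_inv_def)
    also have "\<dots> = transpose sym_onb_inv ** (transpose R ** R) ** sym_onb_inv"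
      unfolding sym_onb_inverse by (simp add: matrix_mul_assoc)
    also have "\<dots> = sym_form 1 ** (sym_onb ** sym_onb_inv)"
      using SO_group_inverse(1)[OF assms] by (simp add: t matrix_mul_assoc)
    finally show ?thesis by (simp add: sym_onb_inverse)
  qed
  ultimately obtain A where A: "A \<in> SL2" "sym2_matrix A = S"
    using sym2_matrix_surj by blast
  have "spin A = (sym_onb_inv ** sym_onb) ** R ** (sym_onb_inv ** sym_onb)"
    unfolding spin_def A(2) S_def by (simp only: matrix_mul_assoc)
  then show ?thesis using that A(1) by (simp add: sym_onb_inverse)
qed

text \<open>For A with rows (a, b) and (c, d) in SL(2,C), the entries of \<open>sym2_matrix A\<close> include \<open>a\<^sup>2\<close>, \<open>2ab\<close>, \<open>ac\<close>
and \<open>ad + bc = 2ad - 1\<close>. Given a square root a of the first one, the others determine A.\<close>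

definition sym2_sqrt :: "complex^3^3 \<Rightarrow> complex^2^2" where
  "sym2_sqrt S = (let a = csqrt (S$1$1) in
     vector [vector [a, S$1$2 / (2 * a)], vector [S$2$1 / a, (S$2$2 + 1) / (2 * a)]])"

lemma sym2_sqrt_sym2:
  assumes "A \<in> SL2" "0 < Re (A$1$1)"
  shows "sym2_sqrt (sym2_matrix A) = A"
proof -
  have nz: "A$1$1 \<noteq> 0" using assms(2) by auto
  have "csqrt ((A$1$1)\<^sup>2) = A$1$1" using assms(2) by (simp add: csqrt_square)
  moreover have "(A$1$1 * A$2$2 + A$1$2 * A$2$1 + 1) / (2 * A$1$1) = A$2$2"
  proof -
    have e: "A$1$1 * A$2$2 + A$1$2 * A$2$1 + 1 = A$2$2 * (2 * A$1$1)"
      using assms(1) by (simp add: SL2_def det_2 algebra_simps)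
    show ?thesis unfolding e using nz by simp
  qed
  ultimately show ?thesis
    unfolding sym2_sqrt_def sym2_matrix_entries using nz
    by (simp add: vec_eq_iff forall_2 vector_3 Let_def)
qed

lemma square_nonpos_iff: "(z::complex)\<^sup>2 \<in> \<real>\<^sub>\<le>\<^sub>0 \<longleftrightarrow> Re z = 0"
proof
  assume "z\<^sup>2 \<in> \<real>\<^sub>\<le>\<^sub>0"
  then have "(Re z)\<^sup>2 \<le> (Im z)\<^sup>2" "Re z * Im z = 0"
    by (auto simp: complex_nonpos_Reals_iff power2_eq_square)
  then show "Re z = 0" by auto
next
  assume "Re z = 0" then show "z\<^sup>2 \<in> \<real>\<^sub>\<le>\<^sub>0"
    by (auto simp: complex_nonpos_Reals_iff power2_eq_square)
qed

text \<open>The section of the covering over the neighbourhood of the identity on which \<open>spin_entry\<close>, the square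
of the upper left entry of a lift, stays off the branch cut of the square root.\<close>

definition spin_sqrt :: "complex^3^3 \<Rightarrow> complex^2^2" where
  "spin_sqrt R = sym2_sqrt (sym_onb ** R ** sym_onb_inv)"

definition spin_entry :: "complex^3^3 \<Rightarrow> complex" where
  "spin_entry R = (sym_onb ** R ** sym_onb_inv) $ 1 $ 1"

lemma spin_sqrt_spin:
  assumes "A \<in> SL2" "0 < Re (A$1$1)"
  shows "spin_sqrt (spin A) = A"
  unfolding spin_sqrt_def sym2_spin[symmetric] using sym2_sqrt_sym2[OF assms] .

lemma spin_entry_spin: "spin_entry (spin A) = (A$1$1)\<^sup>2"
  unfolding spin_entry_def sym2_spin[symmetric] sym2_matrix_entries by (simp add: vector_3)

text \<open>The kernel of the symmetric square on SL(2,C) consists of 1 and -1.\<close>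

lemma spin_eq_imp:
  assumes A: "A \<in> SL2" and B: "B \<in> SL2" and eq: "spin A = spin B"
  shows "B = A \<or> B = - A"
proof -
  define M where "M = adj2 A ** B"
  have M: "M \<in> SL2" unfolding M_def using A B by (intro SL2_mult SL2_adj2)
  have "spin M = spin (adj2 A ** A)" by (simp add: M_def spin_mult eq)
  then have "sym2_matrix M = mat 1"
    using A by (simp add: adj2_mult sym2_spin spin_1 sym_onb_inverse)
  then have e: "(M$1$1)\<^sup>2 = 1" "M$1$1 * M$2$1 = 0" "2 * M$1$1 * M$1$2 = 0"
    unfolding sym2_matrix_entries vec_eq_iff forall_3 by (simp_all add: mat_def vector_3)
  from M have d: "M$1$1 * M$2$2 - M$1$2 * M$2$1 = 1" by (simp add: SL2_def det_2)
  have B': "B = A ** M" unfolding M_def using A by (simp add: matrix_mul_assoc adj2_mult)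
  from e(1) have "M$1$1 = 1 \<or> M$1$1 = -1" by (simp add: power2_eq_1_iff)
  then have "M = mat 1 \<or> M = - mat 1"
  proof
    assume "M$1$1 = 1"
    then have "M = mat 1" using e d by (simp add: vec_eq_iff forall_2 mat_def)
    then show ?thesis ..
  next
    assume m: "M$1$1 = -1"
    then have "M$2$2 = -1" using e d by (simp add: minus_equation_iff[of "M$2$2"])
    then have "M = - mat 1" using e m by (simp add: vec_eq_iff forall_2 mat_def)
    then show ?thesis ..
  qed
  then show ?thesis unfolding B'
  proof
    assume M: "M = - mat 1"
    have "A ** M = - A" unfolding M by (simp add: matrix_matrix_mult_def vec_eq_iff mat_def sum_2 forall_2)
    then show "A ** M = A \<or> A ** M = - A" ..
  qed simp
qed

lemma continuous_on_matrix_mult [continuous_intros]: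
  fixes A :: "'z::topological_space \<Rightarrow> complex^'n^'m" and B :: "'z \<Rightarrow> complex^'k^'n"
  assumes "continuous_on S A" "continuous_on S B"
  shows "continuous_on S (\<lambda>x. A x ** B x)"
  unfolding matrix_matrix_mult_def by (intro continuous_intros assms)

lemma continuous_on_transpose [continuous_intros]:
  fixes A :: "'z::topological_space \<Rightarrow> complex^'n^'m"
  assumes "continuous_on S A"
  shows "continuous_on S (\<lambda>x. transpose (A x))"
  unfolding transpose_def by (intro continuous_intros assms)

lemma continuous_on_matrixI:
  fixes A :: "'z::topological_space \<Rightarrow> complex^'n^'m"
  assumes "\<And>i j. continuous_on S (\<lambda>x. A x $ i $ j)"
  shows "continuous_on S A"
proof -
  have "continuous_on S (\<lambda>x. \<chi> i j. A x $ i $ j)" by (intro continuous_intros assms)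
  then show ?thesis by simp
qed

lemma continuous_on_matrix2I:
  fixes A :: "'z::topological_space \<Rightarrow> complex^2^2"
  assumes "continuous_on S (\<lambda>x. A x $ 1 $ 1)" "continuous_on S (\<lambda>x. A x $ 1 $ 2)"
    "continuous_on S (\<lambda>x. A x $ 2 $ 1)" "continuous_on S (\<lambda>x. A x $ 2 $ 2)"
  shows "continuous_on S A"
proof (rule continuous_on_matrixI)
  show "continuous_on S (\<lambda>x. A x $ i $ j)" for i j
    using exhaust_2[of i] exhaust_2[of j] assms by auto
qed

lemma continuous_on_kron [continuous_intros]:
  fixes A :: "'z::topological_space \<Rightarrow> complex^'n^'n" and B :: "'z \<Rightarrow> complex^'m^'m"
  assumes "continuous_on S A" "continuous_on S B"
  shows "continuous_on S (\<lambda>x. kron (A x) (B x))"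
  unfolding kron_def by (intro continuous_intros assms)

lemma continuous_on_spin [continuous_intros]:
  fixes A :: "'z::topological_space \<Rightarrow> complex^2^2"
  assumes "continuous_on S A"
  shows "continuous_on S (\<lambda>x. spin (A x))"
  unfolding spin_def sym2_matrix_def by (intro continuous_intros assms)

lemma continuous_on_adj2 [continuous_intros]:
  fixes A :: "'z::topological_space \<Rightarrow> complex^2^2"
  assumes "continuous_on S A"
  shows "continuous_on S (\<lambda>x. adj2 (A x))"
  by (rule continuous_on_matrix2I) (simp_all add: adj2_def, (intro continuous_intros assms)+)

lemma continuous_on_spin_sqrt:
  fixes R :: "'z::topological_space \<Rightarrow> complex^3^3"
  assumes R: "continuous_on S R" and nn: "\<And>x. x \<in> S \<Longrightarrow> spin_entry (R x) \<notin> \<real>\<^sub>\<le>\<^sub>0"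
  shows "continuous_on S (\<lambda>x. spin_sqrt (R x))"
proof -
  define M where "M = (\<lambda>x. sym_onb ** R x ** sym_onb_inv)"
  have M: "continuous_on S M" unfolding M_def by (intro continuous_intros R)
  have e: "continuous_on S (\<lambda>x. M x $ i $ j)" for i j
    by (intro continuous_intros M)
  have nn': "M x $ 1 $ 1 \<notin> \<real>\<^sub>\<le>\<^sub>0" if "x \<in> S" for x
    using nn[OF that] unfolding spin_entry_def M_def .
  then have nz: "csqrt (M x $ 1 $ 1) \<noteq> 0" if "x \<in> S" for x
    using nn'[OF that] by auto
  have sq: "continuous_on S (\<lambda>x. csqrt (M x $ 1 $ 1))"
    using nn' by (intro continuous_on_compose2[OF continuous_on_csqrt e]) auto
  have "spin_sqrt (R x) = sym2_sqrt (M x)" for x by (simp add: spin_sqrt_def M_def)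
  then show ?thesis
    by (simp only:, intro continuous_on_matrix2I)
       (simp_all add: sym2_sqrt_def Let_def, (intro continuous_intros e sq; use nz in simp)+)
qed

lemma matrix_mult_scaleR_right:
  fixes A :: "complex^'n^'m" shows "A ** (s *\<^sub>R B) = s *\<^sub>R (A ** B)"
  by (simp add: matrix_matrix_mult_def vec_eq_iff scaleR_sum_right)

lemma homeomorphism_inverse_functions:
  assumes "continuous_on S f" "continuous_on T g" "\<And>x. x \<in> S \<Longrightarrow> f x \<in> T" "\<And>y. y \<in> T \<Longrightarrow> g y \<in> S"
    "\<And>x. x \<in> S \<Longrightarrow> g (f x) = x" "\<And>y. y \<in> T \<Longrightarrow> f (g y) = y"
  shows "homeomorphism S T f g"
proof -
  have "T \<subseteq> f ` S" using assms(4,6) by (auto intro!: image_eqI[where x = "g _"])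
  moreover have "S \<subseteq> g ` T" using assms(3,5) by (auto intro!: image_eqI[where x = "f _"])
  ultimately show ?thesis
    unfolding homeomorphism_def using assms by auto
qed

text \<open>Over the domain of \<open>spin_sqrt\<close> the upper left entry of a lift is not purely imaginary. The two sheets are
distinguished by the sign of its real part, and \<open>spin_sqrt\<close> and its negative are the inverses. Left
translation by a lift of x moves this picture to a neighbourhood of x.\<close>

theorem spin_covering: "covering_space SL2 spin SO_group"
proof
  show "continuous_on SL2 spin" by (intro continuous_intros)
  show "spin ` SL2 = SO_group" using spin_in_SO spin_surj by (metis image_eqI image_subsetI subsetI subset_antisym)
  fix x :: "complex^3^3" assume x: "x \<in> SO_group"
  obtain A0 where A0: "A0 \<in> SL2" "spin A0 = x" using spin_surj[OF x] .
  define B0 where "B0 = adj2 A0"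
  have B0: "B0 \<in> SL2" "B0 ** A0 = mat 1" "A0 ** B0 = mat 1"
    using A0 by (auto simp: B0_def SL2_adj2 adj2_mult)
  define T where "T = SO_group \<inter> {R. spin_entry (spin B0 ** R) \<notin> \<real>\<^sub>\<le>\<^sub>0}"
  define U where "U s = SL2 \<inter> {A. 0 < s * Re ((B0 ** A) $ 1 $ 1)}" for s :: real
  define q where "q s R = s *\<^sub>R (A0 ** spin_sqrt (spin B0 ** R))" for s :: real and R :: "complex^3^3"
  have xT: "x \<in> T"
  proof -
    have "spin_entry (spin B0 ** x) = 1"
      unfolding A0(2)[symmetric] spin_mult[symmetric] spin_entry_spin B0(2) by (simp add: mat_def)
    then show ?thesis using x by (simp add: T_def)
  qed
  have eT: "continuous_on UNIV (\<lambda>R. spin_entry (spin B0 ** R))"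
    unfolding spin_entry_def by (intro continuous_intros)
  have "open {R. spin_entry (spin B0 ** R) \<notin> \<real>\<^sub>\<le>\<^sub>0}"
    using open_vimage[OF open_Compl[OF closed_nonpos_Reals_complex] eT]
    by (simp add: vimage_def)
  then have oT: "openin (top_of_set SO_group) T"
    unfolding T_def by (rule openin_open_Int)
  have oU: "openin (top_of_set SL2) (U s)" for s
    unfolding U_def by (intro openin_open_Int open_Collect_less continuous_intros)
  have spinU: "spin A \<in> T \<longleftrightarrow> Re ((B0 ** A) $ 1 $ 1) \<noteq> 0" if "A \<in> SL2" for A
    unfolding T_def spin_mult[symmetric] using spin_in_SO[OF that] spin_entry_spin[of "B0 ** A"]
    by (simp add: square_nonpos_iff spin_mult[symmetric])
  have Un: "\<Union>{U 1, U (-1)} = SL2 \<inter> spin -` T"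
    using spinU by (fastforce simp: U_def)
  have disj: "pairwise disjnt {U 1, U (-1)}"
    by (auto simp: pairwise_def disjnt_def U_def)
  have sgn: "spin (s *\<^sub>R A) = spin A" "s *\<^sub>R A \<in> SL2 \<longleftrightarrow> A \<in> SL2" "s *\<^sub>R s *\<^sub>R A = A"
    if "s = 1 \<or> s = -1" for s A
    using that SL2_uminus[of A] SL2_uminus[of "- A"] by (auto simp: spin_uminus)
  have homeo: "homeomorphism (U s) T spin (q s)" if s: "s = 1 \<or> s = -1" for s
  proof -
    have q1: "q s (spin A) = A" if A: "A \<in> U s" for A
    proof -
      have "s *\<^sub>R (B0 ** A) \<in> SL2"
        using A B0 sgn(2)[OF s] by (simp add: U_def SL2_mult)
      moreover have "0 < Re ((s *\<^sub>R (B0 ** A)) $ 1 $ 1)" using A by (simp add: U_def)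
      ultimately have "spin_sqrt (spin (s *\<^sub>R (B0 ** A))) = s *\<^sub>R (B0 ** A)"
        by (rule spin_sqrt_spin)
      then have "q s (spin A) = s *\<^sub>R (A0 ** (s *\<^sub>R (B0 ** A)))"
        unfolding q_def sgn(1)[OF s] spin_mult by simp
      also have "A0 ** (s *\<^sub>R (B0 ** A)) = s *\<^sub>R ((A0 ** B0) ** A)"
        by (simp add: matrix_mult_scaleR_right matrix_mul_assoc)
      finally show ?thesis using s by (auto simp: B0(3))
    qed
    have q2: "q s R \<in> U s \<and> spin (q s R) = R" if R: "R \<in> T" for R
    proof -
      obtain A where A: "A \<in> SL2" "spin A = R" using R unfolding T_def by (meson IntE spin_surj)
      then have "Re ((B0 ** A) $ 1 $ 1) \<noteq> 0" using spinU R by blast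
      then obtain r :: real where r: "r = 1 \<or> r = -1" "0 < s * Re ((B0 ** (r *\<^sub>R A)) $ 1 $ 1)"
      proof (cases "0 < s * Re ((B0 ** A) $ 1 $ 1)")
        case True then show ?thesis using that[of 1] by simp
      next
        case False
        have "B0 ** (- A) = - (B0 ** A)" using matrix_mult_scaleR_right[of B0 "-1" A] by simp
        then show ?thesis using False that[of "-1"] s \<open>Re ((B0 ** A) $ 1 $ 1) \<noteq> 0\<close>
          by auto
      qed
      then have "r *\<^sub>R A \<in> U s" using A sgn(2)[OF r(1)] by (simp add: U_def)
      moreover have "spin (r *\<^sub>R A) = R" using A sgn(1)[OF r(1)] by simp
      ultimately show ?thesis using q1 by metis
    qed
    have "continuous_on T (q s)"
      unfolding q_def by (intro continuous_intros continuous_on_spin_sqrt) (simp add: T_def)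
    moreover have "continuous_on (U s) spin" by (intro continuous_intros)
    moreover have "spin A \<in> T" if "A \<in> U s" for A using that Un s by auto
    ultimately show ?thesis
      using q1 q2 by (intro homeomorphism_inverse_functions) auto
  qed
  show "\<exists>T. x \<in> T \<and> openin (top_of_set SO_group) T \<and>
       (\<exists>v. \<Union>v = SL2 \<inter> spin -` T \<and> (\<forall>u\<in>v. openin (top_of_set SL2) u) \<and> pairwise disjnt v \<and>
            (\<forall>u\<in>v. \<exists>q. homeomorphism u T spin q))"
    using xT oT oU Un disj homeo[of 1] homeo[of "-1"]
    by (intro exI[of _ T] conjI exI[of _ "{U 1, U (-1)}"]) auto
qed

text \<open>The first column of a matrix in SL(2,C) is any nonzero vector v. Given v, the second column is one
particular solution plus an arbitrary multiple of v, so SL(2,C) is homeomorphic to the product of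
\<open>C\<^sup>2 - {0}\<close> and the complex line. The solution chosen is the conjugate of v, rotated and
divided by the squared norm, which depends continuously on v.\<close>

theorem SL2_simply_connected: "simply_connected SL2"
proof -
  define N where "N a c = a * cnj a + c * cnj c" for a c
  have N: "N a c \<noteq> 0" if "a \<noteq> 0 \<or> c \<noteq> 0" for a c
  proof -
    have "N a c = complex_of_real ((cmod a)\<^sup>2 + (cmod c)\<^sup>2)"
      by (simp only: N_def of_real_add complex_norm_square)
    moreover have "(cmod a)\<^sup>2 + (cmod c)\<^sup>2 \<noteq> 0"
      using that by (simp add: sum_power2_eq_zero_iff)
    ultimately show ?thesis by (metis of_real_eq_0_iff)
  qed
  (* f adds t times the first column to the particular second column; g reads off t as the
     hermitian product of the second column with the first, divided by the squared norm. *)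
  define f :: "(complex \<times> complex) \<times> complex \<Rightarrow> complex^2^2" where
    "f p = (let a = fst (fst p); c = snd (fst p); t = snd p in
       vector [vector [a, t * a - cnj c / N a c], vector [c, t * c + cnj a / N a c]])" for p
  define g :: "complex^2^2 \<Rightarrow> (complex \<times> complex) \<times> complex" where
    "g A = ((A$1$1, A$2$1), (A$1$2 * cnj (A$1$1) + A$2$2 * cnj (A$2$1)) / N (A$1$1) (A$2$1))" for A
  let ?P = "(- {0 :: complex \<times> complex}) \<times> (UNIV :: complex set)"
  have P: "N (fst (fst p)) (snd (fst p)) \<noteq> 0" if "p \<in> ?P" for p
    using that by (intro N) (auto simp: prod_eq_iff)
  have Q: "N (A$1$1) (A$2$1) \<noteq> 0" if "A \<in> SL2" for A
    using that by (intro N) (auto simp: SL2_def det_2)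
  have "continuous_on ?P f"
  proof -
    have "continuous_on ?P (\<lambda>p. N (fst (fst p)) (snd (fst p)))"
      unfolding N_def by (intro continuous_intros)
    then show ?thesis
      by (intro continuous_on_matrix2I; simp add: f_def Let_def; intro continuous_intros; use P in simp)
  qed
  moreover have "continuous_on SL2 g"
  proof -
    have "continuous_on SL2 (\<lambda>A. N (A$1$1) (A$2$1))"
      unfolding N_def by (intro continuous_intros)
    then show ?thesis
      unfolding g_def by (intro continuous_intros) (use Q in auto)
  qed
  moreover have "f p \<in> SL2" if "p \<in> ?P" for p
    proof -
      obtain a c t where p: "p = ((a, c), t)" by (metis prod.exhaust)
      have n: "N a c \<noteq> 0" using P[OF that] p by simp
      have "det (f ((a, c), t)) = (a * cnj a + c * cnj c) / N a c"
        using n by (simp add: f_def det_2 field_simps)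
      then show ?thesis using n by (simp add: SL2_def N_def p)
    qed
  moreover have "g A \<in> ?P" if "A \<in> SL2" for A
    using Q[OF that] by (auto simp: g_def N_def prod_eq_iff)
  moreover have "g (f p) = p" if "p \<in> ?P" for p
    proof -
      obtain a c t where p: "p = ((a, c), t)" by (metis prod.exhaust)
      have n: "N a c \<noteq> 0" using P[OF that] p by simp
      have "(t * a - cnj c / N a c) * cnj a + (t * c + cnj a / N a c) * cnj c = t * N a c"
        by (simp add: N_def algebra_simps)
      then show ?thesis using n by (simp add: p f_def g_def)
    qed
  moreover have "f (g A) = A" if A: "A \<in> SL2" for A
    proof -
      define a b c d where abcd: "a = A$1$1" "b = A$1$2" "c = A$2$1" "d = A$2$2"
      have n: "N a c \<noteq> 0" using Q[OF A] abcd by simp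
      have det: "a * d - b * c = 1" using A by (simp add: SL2_def det_2 abcd)
      have "(b * cnj a + d * cnj c) * a - cnj c = b * N a c + (a * d - b * c - 1) * cnj c"
        by (simp add: N_def algebra_simps)
      then have 1: "(b * cnj a + d * cnj c) / N a c * a - cnj c / N a c = b"
        using n det by (simp add: field_simps)
      have "(b * cnj a + d * cnj c) * c + cnj a = d * N a c - (a * d - b * c - 1) * cnj a"
        by (simp add: N_def algebra_simps)
      then have 2: "(b * cnj a + d * cnj c) / N a c * c + cnj a / N a c = d"
        using n det by (simp add: field_simps)
      show ?thesis
        using 1 2 by (simp add: f_def g_def vec_eq_iff forall_2 abcd[symmetric])
    qed
  ultimately have "homeomorphism ?P SL2 f g"
    by (intro homeomorphism_inverse_functions)
  moreover have "simply_connected ?P"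
    by (intro simply_connected_Times simply_connected_punctured_universe)
       (auto simp: convex_imp_simply_connected)
  ultimately show ?thesis
    using homeomorphic_simply_connected homeomorphic_def by blast
qed

section \<open>Lifting transition functions to SL(2,C)\<close>

definition based_path :: "(real \<Rightarrow> complex^3^3) \<Rightarrow> bool" where
  "based_path \<gamma> \<longleftrightarrow> path \<gamma> \<and> path_image \<gamma> \<subseteq> SO_group \<and> \<gamma> 0 = mat 1"

definition is_spin_lift :: "(real \<Rightarrow> complex^3^3) \<Rightarrow> (real \<Rightarrow> complex^2^2) \<Rightarrow> bool" where
  "is_spin_lift \<gamma> \<eta> \<longleftrightarrow> path \<eta> \<and> path_image \<eta> \<subseteq> SL2 \<and> \<eta> 0 = mat 1 \<and> (\<forall>t\<in>{0..1}. spin (\<eta> t) = \<gamma> t)"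

text \<open>For a path from the identity to a transition matrix, this is the lift of the matrix to SL(2,C) that
the path singles out.\<close>

definition spin_end :: "(real \<Rightarrow> complex^3^3) \<Rightarrow> complex^2^2" where
  "spin_end \<gamma> = (SOME \<eta>. is_spin_lift \<gamma> \<eta>) 1"

lemma spin_lift_exists:
  assumes "based_path \<gamma>"
  obtains \<eta> where "is_spin_lift \<gamma> \<eta>"
proof -
  have g: "path \<gamma>" "path_image \<gamma> \<subseteq> SO_group" "pathstart \<gamma> = spin (mat 1)"
    using assms by (auto simp: based_path_def spin_1 pathstart_def)
  obtain \<eta> where "path \<eta>" "path_image \<eta> \<subseteq> SL2" "pathstart \<eta> = mat 1"
     "\<And>t. t \<in> {0..1} \<Longrightarrow> spin (\<eta> t) = \<gamma> t"
    using covering_space_lift_path_strong[OF spin_covering SL2_1 g] by blast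
  then show ?thesis using that[of \<eta>] by (simp add: is_spin_lift_def pathstart_def)
qed

text \<open>This is uniqueness of path lifting: any lift may be used to compute \<open>spin_end\<close>.\<close>

lemma spin_end_eq:
  assumes "is_spin_lift \<gamma> \<eta>"
  shows "spin_end \<gamma> = \<eta> 1"
proof -
  define \<theta> where "\<theta> = (SOME \<eta>. is_spin_lift \<gamma> \<eta>)"
  have \<theta>: "is_spin_lift \<gamma> \<theta>" unfolding \<theta>_def by (rule someI[of "is_spin_lift \<gamma>", OF assms])
  have "\<theta> 1 = \<eta> 1"
  proof (rule covering_space_lift_unique[OF spin_covering, of \<theta> 0 \<eta> "{0..1}" "\<lambda>t. spin (\<eta> t)"])
    show "continuous_on {0..1} \<eta>" "continuous_on {0..1} \<theta>" "\<eta> \<in> {0..1} \<rightarrow> SL2" "\<theta> \<in> {0..1} \<rightarrow> SL2"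
      using assms \<theta> by (auto simp: is_spin_lift_def path_def path_image_def)
    then show "continuous_on {0..1} (\<lambda>t. spin (\<eta> t))" "(\<lambda>t. spin (\<eta> t)) \<in> {0..1} \<rightarrow> SO_group"
      by (auto intro!: continuous_intros spin_in_SO)
    show "connected {0..1::real}" by simp
  qed (use assms \<theta> in \<open>auto simp: is_spin_lift_def\<close>)
  then show ?thesis by (simp add: spin_end_def \<theta>_def)
qed

lemma spin_end_lifts:
  assumes "based_path \<gamma>"
  shows "spin_end \<gamma> \<in> SL2" "spin (spin_end \<gamma>) = \<gamma> 1"
proof -
  obtain \<eta> where \<eta>: "is_spin_lift \<gamma> \<eta>" using spin_lift_exists[OF assms] .
  then show "spin_end \<gamma> \<in> SL2" "spin (spin_end \<gamma>) = \<gamma> 1"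
    unfolding spin_end_eq[OF \<eta>] by (auto simp: is_spin_lift_def path_image_def)
qed

lemma spin_adj2:
  assumes "A \<in> SL2" shows "spin (adj2 A) = transpose (spin A)"
proof -
  have "spin (adj2 A) ** spin A = mat 1"
    unfolding spin_mult[symmetric] adj2_mult(1)[OF assms] spin_1 ..
  then have "spin (adj2 A) ** (spin A ** transpose (spin A)) = transpose (spin A)"
    by (simp add: matrix_mul_assoc)
  then show ?thesis using SO_group_inverse(2)[OF spin_in_SO[OF assms]] by simp
qed

text \<open>Write a, b, d for the lifts. The path \<open>a b d\<^sup>-\<^sup>1\<close> starts at 1, lifts the loop \<open>\<alpha> \<beta> \<delta>\<^sup>-\<^sup>1\<close>, and
ends at 1 or -1. If the loop is contractible, then its lift is closed, by the monodromy theorem. If the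
lift is closed, then it is contractible because SL(2,C) is simply connected, and so is its image.\<close>

lemma spin_end_mult:
  assumes \<alpha>: "based_path \<alpha>" and \<beta>: "based_path \<beta>" and \<delta>: "based_path \<delta>"
    and triangle: "\<alpha> 1 ** \<beta> 1 ** transpose (\<delta> 1) = mat 1"
  shows "spin_end \<alpha> ** spin_end \<beta>
    = (if loop_class (\<lambda>t. \<alpha> t ** \<beta> t ** transpose (\<delta> t)) = 0 then spin_end \<delta> else - spin_end \<delta>)"
proof -
  obtain a where a: "is_spin_lift \<alpha> a" using spin_lift_exists[OF \<alpha>] .
  obtain b where b: "is_spin_lift \<beta> b" using spin_lift_exists[OF \<beta>] .
  obtain d where d: "is_spin_lift \<delta> d" using spin_lift_exists[OF \<delta>] .
  have SL: "a t \<in> SL2" "b t \<in> SL2" "d t \<in> SL2" if "t \<in> {0..1}" for t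
    using that a b d by (auto simp: is_spin_lift_def path_image_def)
  define \<gamma> where "\<gamma> = (\<lambda>t. \<alpha> t ** \<beta> t ** transpose (\<delta> t))"
  define L where "L = (\<lambda>t. a t ** b t ** adj2 (d t))"
  have L_SL: "L t \<in> SL2" if "t \<in> {0..1}" for t
    unfolding L_def using SL[OF that] by (intro SL2_mult SL2_adj2)
  have spinL: "spin (L t) = \<gamma> t" if "t \<in> {0..1}" for t
    unfolding L_def \<gamma>_def spin_mult spin_adj2[OF SL(3)[OF that]]
    using that a b d by (auto simp: is_spin_lift_def)
  have pL: "path L"
    unfolding L_def path_def using a b d
    by (intro continuous_intros) (auto simp: is_spin_lift_def path_def)
  have piL: "path_image L \<subseteq> SL2" using L_SL by (auto simp: path_image_def)
  have L0: "L 0 = mat 1"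
    using a b d adj2_mult(1)[OF SL2_1] by (simp add: L_def is_spin_lift_def)
  have p\<gamma>: "path \<gamma>"
    unfolding \<gamma>_def path_def using \<alpha> \<beta> \<delta>
    by (intro continuous_intros) (auto simp: based_path_def path_def)
  have pi\<gamma>: "path_image \<gamma> \<subseteq> SO_group"
    using spinL spin_in_SO[OF L_SL] by (auto simp: path_image_def)
  let ?c = "\<lambda>t::real. mat 1 :: complex^2^2"
  let ?k = "\<lambda>t::real. mat 1 :: complex^3^3"
  have pc: "path ?c" "path_image ?c \<subseteq> SL2" "path ?k" "path_image ?k \<subseteq> SO_group"
    using SL2_1 by (auto simp: path_def path_image_def SO_group_def transpose_mat)
  have closed: "homotopic_paths SO_group \<gamma> ?k \<longleftrightarrow> L 1 = mat 1"
  proof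
    assume "homotopic_paths SO_group \<gamma> ?k"
    then have "pathfinish L = pathfinish ?c"
      by (rule covering_space_monodromy[OF spin_covering p\<gamma> pi\<gamma> pc(3,4) _ pL piL _ pc(1,2)])
         (auto simp: spinL spin_1 pathstart_def L0)
    then show "L 1 = mat 1" by (simp add: pathfinish_def)
  next
    assume "L 1 = mat 1"
    then have "homotopic_paths SL2 L ?c"
      using SL2_simply_connected pL piL pc L0
      unfolding simply_connected_eq_homotopic_paths by (simp add: pathstart_def pathfinish_def)
    then have "homotopic_paths SO_group (spin \<circ> L) (spin \<circ> ?c)"
      by (rule homotopic_paths_continuous_image) (auto intro!: continuous_intros spin_in_SO)
    moreover have "homotopic_paths SO_group \<gamma> (spin \<circ> L)"
      by (rule homotopic_paths_eq[OF p\<gamma> pi\<gamma>]) (simp add: spinL)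
    ultimately show "homotopic_paths SO_group \<gamma> ?k"
      by (simp add: o_def spin_1 homotopic_paths_trans)
  qed
  have "spin (mat 1) = spin (L 1)" using spinL[of 1] triangle by (simp add: \<gamma>_def spin_1)
  then have L1: "L 1 = mat 1 \<or> L 1 = - mat 1"
    using spin_eq_imp[OF SL2_1 L_SL[of 1]] by simp
  have "a 1 ** b 1 = L 1 ** d 1"
    unfolding L_def using adj2_mult(1)[OF SL(3)[of 1]] by (simp flip: matrix_mul_assoc)
  moreover have "(- mat 1) ** d 1 = - d 1"
    by (simp add: vec_eq_iff matrix_matrix_mult_def mat_def forall_2 sum_2)
  moreover have "(- mat 1 :: complex^2^2) \<noteq> mat 1"
    by (simp add: vec_eq_iff mat_def forall_2)
  ultimately show ?thesis
    using L1 closed unfolding spin_end_eq[OF a] spin_end_eq[OF b] spin_end_eq[OF d] loop_class_def \<gamma>_def[symmetric]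
    by auto
qed

text \<open>Homotopy lifting yields a continuous family of lifts, and by uniqueness its members compute
\<open>spin_end\<close>.\<close>

lemma spin_end_continuous:
  fixes h :: "complex \<times> real \<Rightarrow> complex^3^3"
  assumes h: "continuous_on (D \<times> {0..1}) h" "h ` (D \<times> {0..1}) \<subseteq> SO_group"
    and h0: "\<And>z. z \<in> D \<Longrightarrow> h (z, 0) = mat 1"
  shows "continuous_on D (\<lambda>z. spin_end (\<lambda>t. h (z, t)))"
proof -
  have him: "h \<in> D \<times> {0..1} \<rightarrow> SO_group" using h(2) by auto
  obtain k where k: "continuous_on (D \<times> {0..1}) k" "k \<in> D \<times> {0..1} \<rightarrow> SL2"
    "\<And>z. z \<in> D \<Longrightarrow> k (z, 0) = mat 1" "\<And>z. z \<in> D \<times> {0..1} \<Longrightarrow> h z = spin (k z)"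
    using covering_space_lift_homotopy_alt[OF spin_covering h(1) him, of "\<lambda>_. mat 1"] h0 SL2_1
    by (auto simp: spin_1)
  have "spin_end (\<lambda>t. h (z, t)) = k (z, 1)" if z: "z \<in> D" for z
  proof (rule spin_end_eq)
    have "continuous_on {0..1} (\<lambda>t. k (z, t))"
      using z by (intro continuous_on_compose2[OF k(1)] continuous_intros) auto
    then show "is_spin_lift (\<lambda>t. h (z, t)) (\<lambda>t. k (z, t))"
      using z k(2,3,4) by (auto simp: is_spin_lift_def path_def path_image_def)
  qed
  moreover have "continuous_on D (\<lambda>z. k (z, 1))"
    by (intro continuous_on_compose2[OF k(1)] continuous_intros) auto
  ultimately show ?thesis by (simp cong: continuous_on_cong)
qed

lemma holomorphic_on_local:
  assumes "\<And>z. z \<in> D \<Longrightarrow> \<exists>W. open W \<and> z \<in> W \<and> f holomorphic_on W"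
  shows "f holomorphic_on D"
  unfolding holomorphic_on_def
proof
  fix z assume "z \<in> D"
  then obtain W where "open W" "z \<in> W" "f holomorphic_on W" using assms by blast
  then show "f field_differentiable at z within D"
    by (meson field_differentiable_at_within holomorphic_on_imp_differentiable_at)
qed

lemma holomorphic_matrix_mult:
  fixes A :: "complex \<Rightarrow> complex^'n^'m" and B :: "complex \<Rightarrow> complex^'k^'n"
  assumes "\<And>i j. (\<lambda>z. A z $ i $ j) holomorphic_on D" "\<And>i j. (\<lambda>z. B z $ i $ j) holomorphic_on D"
  shows "(\<lambda>z. (A z ** B z) $ i $ j) holomorphic_on D"
  unfolding matrix_matrix_mult_def by (auto intro!: holomorphic_intros assms)

text \<open>Near each point the continuous lift G stays on one sheet of the covering, on which it is a translate
of the holomorphic local inverse \<open>sym2_sqrt\<close>.\<close>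

lemma spin_lift_holomorphic:
  assumes D: "open D" and G: "continuous_on D G" "\<And>z. z \<in> D \<Longrightarrow> G z \<in> SL2"
    and hol: "\<And>i j. (\<lambda>z. spin (G z) $ i $ j) holomorphic_on D"
  shows "(\<lambda>z. G z $ i $ j) holomorphic_on D"
proof (rule holomorphic_on_local)
  fix z0 assume z0: "z0 \<in> D"
  define B0 where "B0 = adj2 (G z0)"
  (* On W the translate of G by the inverse of its value at z0 lies on the sheet of the identity. *)
  define W where "W = {z \<in> D. 0 < Re ((B0 ** G z) $ 1 $ 1)}"
  define M where "M = (\<lambda>z. sym_onb ** (spin B0 ** spin (G z)) ** sym_onb_inv)"
  have B0: "B0 \<in> SL2" "B0 ** G z0 = mat 1" "G z0 ** B0 = mat 1"
    using G(2)[OF z0] by (auto simp: B0_def SL2_adj2 adj2_mult)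
  have "continuous_on D (\<lambda>z. Re ((B0 ** G z) $ 1 $ 1))"
    by (intro continuous_intros G(1))
  from continuous_open_preimage[OF this D, of "{0<..}"] have "open W"
    by (simp add: W_def vimage_def Int_def)
  moreover have "z0 \<in> W" using z0 by (simp add: W_def B0(2) mat_def)
  moreover have "(\<lambda>z. G z $ i $ j) holomorphic_on W"
  proof -
    have M: "(\<lambda>z. M z $ i $ j) holomorphic_on W" for i j
      unfolding M_def
      by (intro holomorphic_matrix_mult holomorphic_on_const holomorphic_on_subset[OF hol])
         (auto simp: W_def)
    have M11: "M z $ 1 $ 1 \<notin> \<real>\<^sub>\<le>\<^sub>0" if "z \<in> W" for z
    proof -
      have "M z $ 1 $ 1 = ((B0 ** G z) $ 1 $ 1)\<^sup>2"
        unfolding M_def spin_mult[symmetric] using spin_entry_spin[of "B0 ** G z"]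
        by (simp add: spin_entry_def)
      then show ?thesis using that by (simp add: square_nonpos_iff W_def)
    qed
    then have nz: "csqrt (M z $ 1 $ 1) \<noteq> 0" if "z \<in> W" for z using M11[OF that] by auto
    have sq: "(\<lambda>z. csqrt (M z $ 1 $ 1)) holomorphic_on W"
      by (intro holomorphic_on_csqrt' M M11)
    have "(\<lambda>z. sym2_sqrt (M z) $ i $ j) holomorphic_on W" for i j
      using exhaust_2[of i] exhaust_2[of j] nz
      by (auto simp: sym2_sqrt_def Let_def intro!: holomorphic_intros sq M)
    then have "(\<lambda>z. (G z0 ** sym2_sqrt (M z)) $ i $ j) holomorphic_on W"
      by (intro holomorphic_matrix_mult holomorphic_on_const)
    moreover have "G z = G z0 ** sym2_sqrt (M z)" if "z \<in> W" for z
    proof -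
      have "sym2_sqrt (M z) = spin_sqrt (spin (B0 ** G z))"
        by (simp add: M_def spin_sqrt_def spin_mult)
      also have "\<dots> = B0 ** G z"
        using that B0(1) G(2) by (intro spin_sqrt_spin SL2_mult) (auto simp: W_def)
      finally show ?thesis by (simp add: matrix_mul_assoc B0(3))
    qed
    ultimately show ?thesis by (metis (no_types, lifting) holomorphic_transform)
  qed
  ultimately show "\<exists>W. open W \<and> z0 \<in> W \<and> (\<lambda>z. G z $ i $ j) holomorphic_on W" by blast
qed

lemma chart_image_open:
  assumes RS: "riemann_surface X" and c: "c \<in> X" and S: "open S"
  shows "open (snd c ` (fst c \<inter> S))"
proof -
  have h: "open (snd c ` fst c)" "homeomorphism (fst c) (snd c ` fst c) (snd c) (chart_inv c)"
    using RS c unfolding riemann_surface_def by blast+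
  then have "open (snd c ` fst c \<inter> chart_inv c -` S)"
    using S by (intro continuous_open_preimage) (auto simp: homeomorphism_def)
  moreover have "snd c ` fst c \<inter> chart_inv c -` S = snd c ` (fst c \<inter> S)"
    using chart_inv_coordinate[OF RS c] by auto
  ultimately show ?thesis by simp
qed

lemma chart_inv_continuous:
  assumes RS: "riemann_surface X" and c: "c \<in> X"
  shows "continuous_on (snd c ` (fst c \<inter> S)) (chart_inv c)"
proof -
  have "homeomorphism (fst c) (snd c ` fst c) (snd c) (chart_inv c)"
    using RS c unfolding riemann_surface_def by blast
  then have "continuous_on (snd c ` fst c) (chart_inv c)" by (simp add: homeomorphism_def)
  then show ?thesis by (rule continuous_on_subset) auto
qed

text \<open>Seen in a coordinate, the end points of the lifts form a continuous lift of a holomorphic map.\<close>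

lemma spin_end_holo:
  assumes RS: "riemann_surface X" and S: "open S"
    and h: "continuous_on (S \<times> {0..1::real}) h" "h ` (S \<times> {0..1}) \<subseteq> SO_group"
    and h0: "\<And>x. x \<in> S \<Longrightarrow> h (x, 0) = mat 1"
    and h1: "matrix_holo_on X S (\<lambda>x. h (x, 1))"
  shows "matrix_holo_on X S (\<lambda>x. spin_end (\<lambda>t. h (x, t)))"
  unfolding matrix_holo_on_def holo_on_def
proof (intro allI ballI)
  fix i j c assume c: "c \<in> X"
  let ?D = "snd c ` (fst c \<inter> S)"
  let ?h = "\<lambda>p. h (chart_inv c (fst p), snd p)"
  have inS: "chart_inv c z \<in> S" if "z \<in> ?D" for z
    using that chart_inv_coordinate[OF RS c] by auto
  have based: "based_path (\<lambda>t. h (x, t))" if "x \<in> S" for x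
  proof -
    have "continuous_on {0..1} (\<lambda>t. h (x, t))"
      using that by (intro continuous_on_compose2[OF h(1)] continuous_intros) auto
    then show ?thesis using that h(2) h0 by (auto simp: based_path_def path_def path_image_def)
  qed
  have cont: "continuous_on ?D (\<lambda>z. spin_end (\<lambda>t. ?h (z, t)))"
  proof (rule spin_end_continuous)
    show "continuous_on (?D \<times> {0..1}) ?h"
      using inS by (intro continuous_on_compose2[OF h(1)] continuous_intros
          continuous_on_compose2[OF chart_inv_continuous[OF RS c]]) auto
    show "?h ` (?D \<times> {0..1}) \<subseteq> SO_group"
      using inS h(2) by auto
    show "?h (z, 0) = mat 1" if "z \<in> ?D" for z using h0 inS[OF that] by simp
  qed
  have "(\<lambda>z. spin_end (\<lambda>t. h (chart_inv c z, t)) $ i $ j) holomorphic_on ?D"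
  proof (rule spin_lift_holomorphic[OF chart_image_open[OF RS c S]])
    show "continuous_on ?D (\<lambda>z. spin_end (\<lambda>t. h (chart_inv c z, t)))" using cont by simp
    show "spin_end (\<lambda>t. h (chart_inv c z, t)) \<in> SL2" if "z \<in> ?D" for z
      by (rule spin_end_lifts(1)[OF based[OF inS[OF that]]])
    have "(\<lambda>z. h (chart_inv c z, 1) $ i $ j) holomorphic_on ?D" for i j
      using h1 c unfolding matrix_holo_on_def holo_on_def by (simp add: o_def)
    then show "(\<lambda>z. spin (spin_end (\<lambda>t. h (chart_inv c z, t))) $ i $ j) holomorphic_on ?D" for i j
      using spin_end_lifts(2)[OF based[OF inS]] by (simp cong: holomorphic_cong)
  qed
  then show "((\<lambda>x. spin_end (\<lambda>t. h (x, t)) $ i $ j) \<circ> chart_inv c) holomorphic_on ?D"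
    by (simp add: o_def)
qed

lemma matrix_holo_local:
  assumes RS: "riemann_surface X" and S: "open S"
    and loc: "\<And>x. x \<in> S \<Longrightarrow> \<exists>R. open R \<and> x \<in> R \<and> matrix_holo_on X (S \<inter> R) A"
  shows "matrix_holo_on X S A"
  unfolding matrix_holo_on_def holo_on_def
proof (intro allI ballI)
  fix i j c assume c: "c \<in> X"
  show "((\<lambda>x. A x $ i $ j) \<circ> chart_inv c) holomorphic_on snd c ` (fst c \<inter> S)"
  proof (rule holomorphic_on_local)
    fix z assume "z \<in> snd c ` (fst c \<inter> S)"
    then obtain x where x: "z = snd c x" "x \<in> fst c" "x \<in> S" by auto
    obtain R where R: "open R" "x \<in> R" "matrix_holo_on X (S \<inter> R) A" using loc[OF x(3)] by blast
    show "\<exists>W. open W \<and> z \<in> W \<and> ((\<lambda>x. A x $ i $ j) \<circ> chart_inv c) holomorphic_on W"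
      using R x c chart_image_open[OF RS c open_Int[OF S R(1)]]
      unfolding matrix_holo_on_def holo_on_def
      by (intro exI[of _ "snd c ` (fst c \<inter> (S \<inter> R))"]) auto
  qed
qed

section \<open>The spinor bundle of an orthogonal bundle of rank three\<close>

text \<open>The inverse of an orthonormal frame F is \<open>F\<^sup>T Q\<close>. Hence the transition matrix is \<open>F\<^sup>T Q F'\<close>, which
is polynomial in the entries of F, Q and F' with respect to any holomorphic frame.\<close>

lemma orthonormal_transition_holo:
  assumes RS: "riemann_surface X" and E: "orth_bundle X E"
    and F: "orthonormal_frame X E S F" and F': "orthonormal_frame X E S' F'"
  shows "matrix_holo_on X (S \<inter> S') (\<lambda>x. matrix_inv (F x) ** F' x)"
proof (rule matrix_holo_local[OF RS])
  have lf: "local_frame X (frames E) S F" "local_frame X (frames E) S' F'"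
    using F F' unfolding orthonormal_frame_def by blast+
  show "open (S \<inter> S')" using lf unfolding local_frame_def by blast
  fix x assume "x \<in> S \<inter> S'"
  have hb: "holomorphic_bundle X (frames E)" using E unfolding orth_bundle_def by blast
  obtain R G where RG: "(R, G) \<in> frames E" "x \<in> R" using bundle_cover[OF hb] .
  have R: "open R" "\<And>y. y \<in> R \<Longrightarrow> invertible (G y)"
    using hb RG unfolding holomorphic_bundle_def by blast+
  have g: "matrix_holo_on X R (\<lambda>x. transpose (G x) ** form E x ** G x)"
    using E RG unfolding orth_bundle_def holomorphic_form_def by blast
  have f: "matrix_holo_on X (S \<inter> R) (\<lambda>x. matrix_inv (G x) ** F x)"
    "matrix_holo_on X (S' \<inter> R) (\<lambda>x. matrix_inv (G x) ** F' x)"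
    using lf RG unfolding local_frame_def by blast+
  have "matrix_holo_on X (S \<inter> S' \<inter> R) (\<lambda>x. matrix_inv (F x) ** F' x)"
  proof (subst matrix_holo_cong[OF RS])
    show "matrix_holo_on X (S \<inter> S' \<inter> R) (\<lambda>x. transpose (matrix_inv (G x) ** F x)
       ** (transpose (G x) ** form E x ** G x) ** (matrix_inv (G x) ** F' x))"
      by (intro matrix_holo_mult matrix_holo_transpose matrix_holo_subset[OF f(1)]
          matrix_holo_subset[OF f(2)] matrix_holo_subset[OF g]) auto
    fix y assume y: "y \<in> S \<inter> S' \<inter> R"
    have G: "G y ** matrix_inv (G y) = mat 1" using R(2) y by (simp add: matrix_inv_mult)
    have o: "transpose (F y) ** form E y ** F y = mat 1"
      using F y unfolding orthonormal_frame_def by blast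
    then have "matrix_inv (F y) = transpose (F y) ** form E y"
      using matrix_inv_unique(1)[of "F y" "transpose (F y) ** form E y"] matrix_left_right_inverse by blast
    moreover have "transpose (matrix_inv (G y) ** F y)
       ** (transpose (G y) ** form E y ** G y) ** (matrix_inv (G y) ** F' y)
      = transpose (G y ** matrix_inv (G y) ** F y) ** form E y ** (G y ** matrix_inv (G y)) ** F' y"
      by (simp add: matrix_transpose_mul matrix_mul_assoc)
    ultimately show "matrix_inv (F y) ** F' y = transpose (matrix_inv (G y) ** F y)
       ** (transpose (G y) ** form E y ** G y) ** (matrix_inv (G y) ** F' y)"
      by (simp add: G)
  qed
  then show "\<exists>R. open R \<and> x \<in> R \<and> matrix_holo_on X (S \<inter> S' \<inter> R) (\<lambda>x. matrix_inv (F x) ** F' x)"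
    using R RG by blast
qed

definition twist :: "bit \<Rightarrow> complex^2^2 \<Rightarrow> complex^2^2" where
  "twist b A = (if b = 0 then A else - A)"

lemma uminus_matrix_mult:
  fixes A :: "complex^'n^'m" and B :: "complex^'k^'n"
  shows "(- A) ** B = - (A ** B)" "A ** (- B) = - (A ** B)"
  by (simp_all add: matrix_matrix_mult_def vec_eq_iff sum_negf)

lemma twist_mult: "twist b A ** twist c B = twist (b + c) (A ** B)"
  by (cases "b = 0"; cases "c = 0") (simp_all add: twist_def uminus_matrix_mult)

lemma twist_twist: "twist b (twist c A) = twist (b + c) A"
  by (cases "b = 0"; cases "c = 0") (simp_all add: twist_def)

lemma twist_SL2: "A \<in> SL2 \<Longrightarrow> twist b A \<in> SL2"
  by (simp add: twist_def SL2_uminus)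

lemma spin_twist: "spin (twist b A) = spin A"
  by (simp add: twist_def spin_uminus)

lemma twist_holo:
  assumes RS: "riemann_surface X" and S: "open S" and A: "matrix_holo_on X S A"
    and b: "\<And>x. x \<in> S \<Longrightarrow> \<forall>\<^sub>F y in at x. b y = b x"
  shows "matrix_holo_on X S (\<lambda>x. twist (b x) (A x))"
proof (rule matrix_holo_local[OF RS S])
  fix x assume "x \<in> S"
  from b[OF this] obtain R where R: "open R" "x \<in> R" "\<And>y. y \<in> R \<Longrightarrow> y \<noteq> x \<Longrightarrow> b y = b x"
    unfolding eventually_at_topological by auto
  have "matrix_holo_on X (S \<inter> R) (\<lambda>y. twist (b y) (A y))"
  proof (subst matrix_holo_cong[OF RS])
    show "matrix_holo_on X (S \<inter> R) (\<lambda>y. twist (b x) (A y))"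
    proof -
      have "matrix_holo_on X (S \<inter> R) A" by (rule matrix_holo_subset[OF A]) simp
      then show ?thesis
        by (cases "b x = 0") (simp_all add: twist_def matrix_holo_uminus)
    qed
    show "twist (b y) (A y) = twist (b x) (A y)" if "y \<in> S \<inter> R" for y
      using that R(3)[of y] by (cases "y = x") auto
  qed
  with R(1,2) show "\<exists>R. open R \<and> x \<in> R \<and> matrix_holo_on X (S \<inter> R) (\<lambda>x. twist (b x) (A x))"
    by (intro exI[of _ R] conjI)
qed

text \<open>The lifts H of the transition functions satisfy the cocycle condition up to the sign given by w. When
w is the coboundary of b, the signs given by b compensate this.\<close>

theorem spin_cocycle:
  assumes RS: "riemann_surface X" and E: "orth_bundle X E" and w2: "w2_vanishes X (E :: ('a::t2_space, 3) orth_bundle)"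
  obtains U F G where "\<And>i. i \<in> U i" "\<And>i. orthonormal_frame X E (U i) (F i)"
    "\<And>i j x. x \<in> U i \<inter> U j \<Longrightarrow> G i j x \<in> SL2"
    "\<And>i j x. x \<in> U i \<inter> U j \<Longrightarrow> spin (G i j x) = matrix_inv (F i x) ** F j x"
    "\<And>i j. matrix_holo_on X (U i \<inter> U j) (G i j)"
    "\<And>i j k x. x \<in> U i \<inter> U j \<inter> U k \<Longrightarrow> G i j x ** G j k x = G i k x"
proof -
  obtain U w where w: "w2_cocycle X E U w" and cb: "coboundary U w"
    using w2 unfolding w2_vanishes_def by blast
  have U: "i \<in> U i" for i
    using w unfolding w2_cocycle_def by simp
  obtain F h where F': "\<forall>i. orthonormal_frame X E (U i) (F i)"
    and h': "\<forall>i j. continuous_on ((U i \<inter> U j) \<times> {0..1::real}) (h i j) \<and>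
           h i j ` ((U i \<inter> U j) \<times> {0..1}) \<subseteq> SO_group \<and>
           (\<forall>x\<in>U i \<inter> U j. h i j (x, 0) = mat 1 \<and> h i j (x, 1) = matrix_inv (F i x) ** F j x)"
    and wh': "\<forall>i j k. \<forall>x\<in>U i \<inter> U j \<inter> U k. w i j k x =
           loop_class (\<lambda>t. h i j (x, t) ** h j k (x, t) ** transpose (h i k (x, t)))"
    using w[unfolded w2_cocycle_def, THEN conjunct2] by (elim exE conjE)
  have F: "orthonormal_frame X E (U i) (F i)" for i using F' by simp
  have h: "continuous_on ((U i \<inter> U j) \<times> {0..1::real}) (h i j)"
      "h i j ` ((U i \<inter> U j) \<times> {0..1}) \<subseteq> SO_group"
      "x \<in> U i \<inter> U j \<Longrightarrow> h i j (x, 0) = mat 1"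
      "x \<in> U i \<inter> U j \<Longrightarrow> h i j (x, 1) = matrix_inv (F i x) ** F j x" for i j x
    using h'[rule_format, of i j] by simp_all
  note wh = wh'[rule_format]
  obtain b where b': "\<forall>i j. \<forall>x\<in>U i \<inter> U j. \<forall>\<^sub>F y in at x. b i j y = b i j x"
    and wb': "\<forall>i j k. \<forall>x\<in>U i \<inter> U j \<inter> U k. w i j k x = b j k x - b i k x + b i j x"
    using cb[unfolded coboundary_def] by (elim exE conjE)
  note b = b'[rule_format] and wb = wb'[rule_format]
  have Uo: "open (U i)" and Finv: "x \<in> U i \<Longrightarrow> invertible (F i x)" for i x
    using F[of i] unfolding orthonormal_frame_def local_frame_def by blast+
  define H where "H i j x = spin_end (\<lambda>t. h i j (x, t))" for i j x
  define G where "G i j x = twist (b i j x) (H i j x)" for i j x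
  have based: "based_path (\<lambda>t. h i j (x, t))" if "x \<in> U i \<inter> U j" for i j x
  proof -
    have "continuous_on {0..1} (\<lambda>t. h i j (x, t))"
      using that by (intro continuous_on_compose2[OF h(1)] continuous_intros) auto
    moreover have "h i j (x, t) \<in> SO_group" if "t \<in> {0..1}" for t
      using \<open>x \<in> U i \<inter> U j\<close> that h(2)[of i j] by (simp add: image_subset_iff)
    ultimately show ?thesis using that h(3) by (auto simp: based_path_def path_def path_image_def)
  qed
  have holo: "matrix_holo_on X (U i \<inter> U j) (H i j)" for i j
  proof -
    have "matrix_holo_on X (U i \<inter> U j) (\<lambda>x. h i j (x, 1))"
      using orthonormal_transition_holo[OF RS E F F, of i j] h(4)
      by (subst matrix_holo_cong[OF RS]) auto
    then show ?thesis
      unfolding H_def by (intro spin_end_holo[OF RS open_Int[OF Uo Uo]] h)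
  qed
  have coc: "H i j x ** H j k x = twist (w i j k x) (H i k x)" if x: "x \<in> U i \<inter> U j \<inter> U k" for i j k x
  proof -
    have "h i j (x, 1) ** h j k (x, 1) ** transpose (h i k (x, 1)) = mat 1"
    proof -
      have "h i j (x, 1) ** h j k (x, 1) = matrix_inv (F i x) ** (F j x ** matrix_inv (F j x)) ** F k x"
        using x by (simp add: h(4) matrix_mul_assoc)
      then have "h i j (x, 1) ** h j k (x, 1) = h i k (x, 1)"
        using x Finv[of x j] by (simp add: matrix_inv_mult h(4))
      moreover have "h i k (x, 1) \<in> SO_group"
        using x h(2)[of i k] by (simp add: image_subset_iff)
      ultimately show ?thesis using SO_group_inverse(2) by simp
    qed
    from spin_end_mult[OF based[of x i j] based[of x j k] based[of x i k] this] x
    show ?thesis unfolding H_def wh[OF x] twist_def by simp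
  qed
  show ?thesis
  proof (rule that[of U F G])
    show "G i j x \<in> SL2" "spin (G i j x) = matrix_inv (F i x) ** F j x" if "x \<in> U i \<inter> U j" for i j x
      using spin_end_lifts[OF based[OF that]] h(4)[OF that] by (simp_all add: G_def H_def twist_SL2 spin_twist)
    show "matrix_holo_on X (U i \<inter> U j) (G i j)" for i j
      unfolding G_def by (intro twist_holo RS open_Int Uo holo b)
    show "G i j x ** G j k x = G i k x" if x: "x \<in> U i \<inter> U j \<inter> U k" for i j k x
    proof -
      have "b i j x + b j k x + (b j k x - b i k x + b i j x) = b i k x"
        by (cases "b i j x"; cases "b j k x"; cases "b i k x") simp_all
      then show ?thesis
        unfolding G_def twist_mult coc[OF x] twist_twist wb[OF x] by simp
    qed
  qed (use U F in auto)
qed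

definition std_symplectic :: "complex^2^2" where
  "std_symplectic = vector [vector [0, 1], vector [-1, 0]]"

text \<open>The bundle with transition functions G. As x is a point of \<open>U x\<close>, there is a distinguished index at x,
namely x itself, and the fibre at x is identified with the standard plane by the frame with this
index. The frame with index i is then the matrix \<open>G x i x\<close>.\<close>

definition spinor_bundle :: "('a \<Rightarrow> 'a set) \<Rightarrow> ('a \<Rightarrow> 'a \<Rightarrow> 'a \<Rightarrow> complex^2^2) \<Rightarrow> 'a sl2_bundle" where
  "spinor_bundle U G = \<lparr>vframes = (\<lambda>i. (U i, \<lambda>x. G x i x)) ` UNIV, omega = (\<lambda>x. std_symplectic)\<rparr>"

lemma SL2_symplectic: "A \<in> SL2 \<Longrightarrow> transpose A ** std_symplectic ** A = std_symplectic"
  by (simp add: SL2_def det_2 std_symplectic_def mat_entries algebra_simps)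

lemma spinor_bundle_sl2:
  assumes RS: "riemann_surface X" and U: "\<And>i. open (U i)" "\<And>i. i \<in> U i"
    and G: "\<And>i j x. x \<in> U i \<inter> U j \<Longrightarrow> G i j x \<in> SL2"
      "\<And>i j. matrix_holo_on X (U i \<inter> U j) (G i j)"
      "\<And>i j k x. x \<in> U i \<inter> U j \<inter> U k \<Longrightarrow> G i j x ** G j k x = G i k x"
  shows "sl2_bundle X (spinor_bundle U G)"
proof -
  have SL: "G x i x \<in> SL2" if "x \<in> U i" for x i using that U(2) by (intro G(1)) auto
  have tr: "matrix_holo_on X (U i \<inter> U j) (\<lambda>x. matrix_inv (G x i x) ** G x j x)" for i j
  proof (subst matrix_holo_cong[OF RS])
    show "matrix_holo_on X (U i \<inter> U j) (G i j)" by (rule G(2))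
    fix x assume x: "x \<in> U i \<inter> U j"
    then have "G x i x ** G i j x = G x j x" using U(2) by (intro G(3)) auto
    then have "matrix_inv (G x i x) ** G x j x = (matrix_inv (G x i x) ** G x i x) ** G i j x"
      by (simp flip: matrix_mul_assoc)
    then show "matrix_inv (G x i x) ** G x j x = G i j x"
      using SL2_matrix_inv[OF SL[of x i]] adj2_mult(1)[OF SL[of x i]] x by simp
  qed
  have "holomorphic_bundle X (vframes (spinor_bundle U G))"
    unfolding holomorphic_bundle_def
  proof (intro conjI)
    show "(\<Union>(S, F)\<in>vframes (spinor_bundle U G). S) = UNIV"
      using U(2) by (auto simp: spinor_bundle_def)
    show "\<forall>(S, F)\<in>vframes (spinor_bundle U G). open S \<and> (\<forall>x\<in>S. invertible (F x))"
      using U(1) SL2_matrix_inv[OF SL] by (simp add: spinor_bundle_def)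
    show "\<forall>(S, F)\<in>vframes (spinor_bundle U G). \<forall>(S', F')\<in>vframes (spinor_bundle U G).
        matrix_holo_on X (S \<inter> S') (\<lambda>x. matrix_inv (F x) ** F' x)"
      using tr by (simp add: spinor_bundle_def)
  qed
  moreover have "matrix_holo_on X (U i) (\<lambda>x. transpose (G x i x) ** std_symplectic ** G x i x)" for i
    by (subst matrix_holo_cong[OF RS SL2_symplectic[OF SL]]) (auto intro: matrix_holo_const)
  moreover have "transpose std_symplectic = - std_symplectic"
    by (simp add: std_symplectic_def mat_entries)
  moreover have "invertible std_symplectic"
    by (simp add: invertible_det_nz det_2 std_symplectic_def)
  ultimately show ?thesis
    unfolding sl2_bundle_def holomorphic_form_def by (simp add: spinor_bundle_def)
qed

text \<open>The orthonormal frame \<open>F x\<close> of the fibre at x identifies it with the standard one, that is, with the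
symmetric square of the fibre of the spinor bundle. In the frames with index i on both sides, this
identification is the constant matrix \<open>sym_onb_inv\<close>, hence it is holomorphic.\<close>

lemma spinor_bundle_sym2_iso:
  assumes RS: "riemann_surface X" and E: "orth_bundle X (E :: ('a::t2_space, 3) orth_bundle)"
    and w2: "w2_vanishes X E"
  shows "\<exists>(V :: 'a sl2_bundle) T. sl2_bundle X V \<and> orth_iso X T (sym2 V) E"
proof -
  obtain U F G where U: "\<And>i. i \<in> U i" and F: "\<And>i. orthonormal_frame X E (U i) (F i)"
    and G: "\<And>i j x. x \<in> U i \<inter> U j \<Longrightarrow> G i j x \<in> SL2"
    and spinG: "\<And>i j x. x \<in> U i \<inter> U j \<Longrightarrow> spin (G i j x) = matrix_inv (F i x) ** F j x"
    and G': "\<And>i j. matrix_holo_on X (U i \<inter> U j) (G i j)"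
      "\<And>i j k x. x \<in> U i \<inter> U j \<inter> U k \<Longrightarrow> G i j x ** G j k x = G i k x"
    using spin_cocycle[OF RS E w2] by blast
  have lf: "local_frame X (frames E) (U i) (F i)" for i
    using F[of i] unfolding orthonormal_frame_def by blast
  then have Uo: "open (U i)" and Finv: "x \<in> U i \<Longrightarrow> invertible (F i x)" for i x
    unfolding local_frame_def by blast+
  define V where "V = spinor_bundle U G"
  have V: "sl2_bundle X V"
    unfolding V_def by (rule spinor_bundle_sl2[OF RS Uo U G G'])
  define T where "T = (\<lambda>x. F x x ** sym_onb_inv)"
  have T_frame: "T x ** sym2_matrix (G x i x) = F i x ** sym_onb_inv" if x: "x \<in> U i" for x i
  proof -
    have "sym_onb_inv ** sym2_matrix (G x i x) = spin (G x i x) ** sym_onb_inv"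
      unfolding sym2_spin by (simp add: matrix_mul_assoc sym_onb_inverse)
    then have "T x ** sym2_matrix (G x i x) = F x x ** (matrix_inv (F x x) ** F i x) ** sym_onb_inv"
      using spinG[of x x i] x U by (simp add: T_def flip: matrix_mul_assoc)
    then show ?thesis using Finv[OF U, of x] by (simp add: matrix_mul_assoc matrix_inv_mult)
  qed
  have holo: "matrix_holo_on X (U i \<inter> S) (\<lambda>x. matrix_inv (F' x) ** T x ** sym2_matrix (G x i x))"
    if SF: "(S, F') \<in> frames E" for i S F'
  proof (subst matrix_holo_cong[OF RS])
    show "matrix_holo_on X (U i \<inter> S) (\<lambda>x. matrix_inv (F' x) ** F i x ** sym_onb_inv)"
    proof (rule matrix_holo_mult[OF _ matrix_holo_const])
      show "matrix_holo_on X (U i \<inter> S) (\<lambda>x. matrix_inv (F' x) ** F i x)"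
        using lf[of i] SF unfolding local_frame_def by blast
    qed
    show "matrix_inv (F' x) ** T x ** sym2_matrix (G x i x) = matrix_inv (F' x) ** F i x ** sym_onb_inv"
      if "x \<in> U i \<inter> S" for x
      using T_frame[of x i] that by (simp flip: matrix_mul_assoc)
  qed
  have inv: "invertible (T x)" for x
    using Finv[OF U, of x] sym_onb_det by (auto simp: T_def invertible_det_nz det_mul)
  have frs: "frames (sym2 V) = {(S, \<lambda>x. sym2_matrix (F x)) | S F. (S, F) \<in> vframes V}"
    by (simp add: sym2_def)
  have "bundle_iso X T (frames (sym2 V)) (frames E)"
    unfolding bundle_iso_def frs using inv holo by (auto simp: V_def spinor_bundle_def)
  moreover have "transpose (T x) ** form E x ** T x = form (sym2 V) x" for x
  proof -
    have o: "transpose (F x x) ** form E x ** F x x = mat 1"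
      using F[of x] U unfolding orthonormal_frame_def by blast
    have "transpose (T x) ** form E x ** T x
       = transpose sym_onb_inv ** (transpose (F x x) ** form E x ** F x x) ** sym_onb_inv"
      unfolding T_def by (simp add: matrix_transpose_mul matrix_mul_assoc)
    also have "\<dots> = sym_form 1 ** (sym_onb ** sym_onb_inv)"
      unfolding o by (simp add: sym_onb_inv_def matrix_transpose_mul transpose_sym_form matrix_mul_assoc)
    also have "\<dots> = form (sym2 V) x"
      unfolding sym_onb_inverse sym2_orth_bundle(2)[OF RS V] by (simp add: V_def spinor_bundle_def std_symplectic_def)
    finally show ?thesis .
  qed
  ultimately show ?thesis using V unfolding orth_iso_def by blast
qed

theorem theoremA:
  fixes X :: "'a::t2_space chart set" and g :: nat
  assumes "compact_riemann_surface X g" and "g \<ge> 2"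
  shows
    "(\<forall>V. sl2_higgs X V \<longrightarrow>
       (\<exists>\<beta>. let P = \<lparr>O13 = alt2 V, W13 = sym2 V, beta = \<beta>\<rparr> in
          so13_higgs X P \<and>
          so_higgs X (I2 V (neg_higgs V)) \<and>
          so_higgs_iso X index_map (alt_sym_map V) (so13_to_so4 P) (I2 V (neg_higgs V)) \<and>
          (\<forall>S F. local_frame X (vframes V) S F \<and>
             (\<forall>x\<in>S. transpose (F x) ** omega V x ** F x = vector [vector [0, 1], vector [-1, 0]]) \<longrightarrow>
             (\<forall>k\<in>X. \<forall>x\<in>S \<inter> fst k. \<forall>a b c.
                matrix_inv (F x) ** phi V k x ** F x = vector [vector [a, b], vector [c, -a]] \<longrightarrow>
                \<beta> k x ** sym2_matrix (F x) = vector [vector [-c, 2 * a, b]])))) \<and>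
     (\<forall>P. represents_point_of_M_plus_SO13 X P \<longrightarrow>
       (\<exists>(V :: 'a sl2_bundle) T. sl2_bundle X V \<and> orth_iso X T (sym2 V) (W13 P)))"
proof (intro conjI allI impI)
  have RS: "riemann_surface X" using assms(1) unfolding compact_riemann_surface_def by blast
  fix V assume V: "sl2_higgs X V"
  have "\<beta>' k x ** sym2_matrix (F x) = vector [vector [-c, 2 * a, b]]"
    if "\<beta>' = sym_beta V" "local_frame X (vframes V) S F"
      "\<forall>x\<in>S. transpose (F x) ** omega V x ** F x = vector [vector [0, 1], vector [-1, 0]]"
      "x \<in> S \<inter> fst k" "matrix_inv (F x) ** phi V k x ** F x = vector [vector [a, b], vector [c, -a]]"
    for \<beta>' S F k x a b c
    using sym_beta_symplectic[OF V that(2)] that by blast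
  then show "\<exists>\<beta>. let P = \<lparr>O13 = alt2 V, W13 = sym2 V, beta = \<beta>\<rparr> in
          so13_higgs X P \<and>
          so_higgs X (I2 V (neg_higgs V)) \<and>
          so_higgs_iso X index_map (alt_sym_map V) (so13_to_so4 P) (I2 V (neg_higgs V)) \<and>
          (\<forall>S F. local_frame X (vframes V) S F \<and>
             (\<forall>x\<in>S. transpose (F x) ** omega V x ** F x = vector [vector [0, 1], vector [-1, 0]]) \<longrightarrow>
             (\<forall>k\<in>X. \<forall>x\<in>S \<inter> fst k. \<forall>a b c.
                matrix_inv (F x) ** phi V k x ** F x = vector [vector [a, b], vector [c, -a]] \<longrightarrow>
                \<beta> k x ** sym2_matrix (F x) = vector [vector [-c, 2 * a, b]]))"
    using so13_higgs_sym[OF RS V] I2_so_higgs[OF RS V] so_higgs_iso_sym[OF RS V]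
    unfolding Let_def sym_so13_def
    by (intro exI[of _ "sym_beta V"] conjI) blast+
next
  have RS: "riemann_surface X" using assms(1) unfolding compact_riemann_surface_def by blast
  fix P assume "represents_point_of_M_plus_SO13 X P"
  then show "\<exists>(V :: 'a sl2_bundle) T. sl2_bundle X V \<and> orth_iso X T (sym2 V) (W13 P)"
    unfolding represents_point_of_M_plus_SO13_def so13_higgs_def
    by (intro spinor_bundle_sym2_iso[OF RS]) blast+
qed

end
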